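(* Let $f$ be a quadratic rational map and $k\in\mathbb{N}$. Then $\mathrm{Deck}(f^k)$ is isomorphic to one of: the cyclic group $\mathbb{Z}_{2^n}$ for some $n\ge1$, the Klein four-group $V_4$, or the dihedral group $D_8$ of order $8$ (symmetries of a square). Furthermore, if $f$ is not a power map then $|\mathrm{Deck}(f^k)|\le 8$.
   Context: For a rational map $F$, $\mathrm{Deck}(F)=\{\tau \text{ Möbius} : F\circ\tau=F\}$. A power map is a rational map Möbius-conjugate to $z\mapsto z^d$ or $z\mapsto z^{-d}$. $f^k$ is the $k$-th iterate. *)

theory Defs
  imports "HOL-Computational_Algebra.Polynomial" "HOL-Computational_Algebra.Polynomial_Factorial"
    "HOL-Algebra.Elementary_Groups"
begin

text \<open>The Riemann sphere is modelled as \<open>complex option\<close>: \<open>Some z\<close> is the finite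
point z, \<open>None\<close> is the point at infinity.\<close>

type_synonym sphere = "complex option"

text \<open>The map on the sphere induced by the quotient p/q of polynomials
(q nonzero, p and q coprime).\<close>
definition rat_map_of :: "complex poly \<Rightarrow> complex poly \<Rightarrow> sphere \<Rightarrow> sphere" where
  "rat_map_of p q w =
     (case w of
        Some z \<Rightarrow> (if poly q z = 0 then None else Some (poly p z / poly q z))
      | None \<Rightarrow> (if degree p > degree q then None
                 else Some (coeff p (degree q) / lead_coeff q)))"

definition is_rat_map :: "(sphere \<Rightarrow> sphere) \<Rightarrow> nat \<Rightarrow> bool" where
  "is_rat_map F d \<longleftrightarrow>
     (\<exists>p q. q \<noteq> 0 \<and> coprime p q \<and> max (degree p) (degree q) = d \<and> F = rat_map_of p q)"

definition is_mobius :: "(sphere \<Rightarrow> sphere) \<Rightarrow> bool" where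
  "is_mobius \<tau> \<longleftrightarrow> is_rat_map \<tau> 1"

definition Deck :: "(sphere \<Rightarrow> sphere) \<Rightarrow> (sphere \<Rightarrow> sphere) set" where
  "Deck F = {\<tau>. is_mobius \<tau> \<and> F \<circ> \<tau> = F}"

definition deck_group :: "(sphere \<Rightarrow> sphere) \<Rightarrow> (sphere \<Rightarrow> sphere) monoid" where
  "deck_group F = \<lparr>carrier = Deck F, mult = (\<circ>), one = id\<rparr>"

definition pow_map :: "nat \<Rightarrow> sphere \<Rightarrow> sphere" where
  "pow_map d = rat_map_of (monom 1 d) 1"

definition inv_pow_map :: "nat \<Rightarrow> sphere \<Rightarrow> sphere" where
  "inv_pow_map d = rat_map_of 1 (monom 1 d)"

definition is_power_map :: "(sphere \<Rightarrow> sphere) \<Rightarrow> bool" where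
  "is_power_map F \<longleftrightarrow>
     (\<exists>\<mu> d. d \<ge> 1 \<and> is_mobius \<mu> \<and> (F \<circ> \<mu> = \<mu> \<circ> pow_map d \<or> F \<circ> \<mu> = \<mu> \<circ> inv_pow_map d))"

text \<open>Dihedral group of order 8: rotations r^a (a mod 4) and reflections s, pairs (a,e)
meaning r^a s^e, with s r s = r^(-1).\<close>
definition D8 :: "(nat \<times> nat) monoid" where
  "D8 = \<lparr>carrier = {0..<4} \<times> {0..<2},
         mult = (\<lambda>(a, e) (b, f). ((a + (if e = 0 then b else 4 - b)) mod 4, (e + f) mod 2)),
         one = (0, 0)\<rparr>"

definition V4 :: "(int \<times> int) monoid" where
  "V4 = integer_mod_group 2 \<times>\<times> integer_mod_group 2"

end

theory Submission
  imports Defs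
begin

text \<open>A quadratic rational map is Moebius equivalent to squaring, so after conjugation \<open>f = g = M \<circ> sq\<close>
with critical points 0 and infinity and \<open>Deck g\<close> generated by \<open>z \<mapsto> -z\<close>. The local degree of \<open>g\<^sup>k\<close> at x is
2 to the number of visits of the orbit of x to the critical points before time k; it is invariant
under deck transformations. Every deck transformation t of \<open>g\<^sup>k\<close> has 2-power order, because a generic
fibre has \<open>2\<^sup>k\<close> points. The heart of the matter is that t preserves \<open>{0, \<infinity>}\<close>. Otherwise some deck
transformation exchanges 0 and infinity, so both have the same image under \<open>g\<^sup>k\<close> and equally many
visits, and another one is not an involution, so its fixed points make at least two visits and
hence so do 0 and infinity. The image of a critical point under t then has the same image and number of
visits as the critical points, and this is impossible outside \<open>{0, \<infinity>}\<close>.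

So \<open>Deck (g\<^sup>k)\<close> consists of the maps \<open>z \<mapsto> c z\<close> with c in a cyclic 2-group and possibly maps \<open>z \<mapsto> c / z\<close>. If c can
have order 8, then \<open>z \<mapsto> c\<^sup>2 z\<close> conjugated by M is a deck transformation of \<open>g\<^bsup>k-1\<^esup>\<close> of order 4, which forces
M to preserve \<open>{0, \<infinity>}\<close>, so that f is a power map.\<close>

section \<open>Moebius transformations in homogeneous coordinates\<close>

text \<open>Homogeneous coordinates let infinity be handled by the same polynomial formulas as the
  finite points. The pair (0, 0) falls to the default \<open>None\<close>, whence the nonvanishing
  side conditions below.\<close>

definition pr :: "complex \<Rightarrow> complex \<Rightarrow> sphere" where
  "pr x y = (if y = 0 then None else Some (x / y))"

lemma pr_eq_iff:
  assumes "x \<noteq> 0 \<or> y \<noteq> 0" "u \<noteq> 0 \<or> v \<noteq> 0"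
  shows "pr x y = pr u v \<longleftrightarrow> x * v = u * y"
  using assms by (auto simp: pr_def field_simps)

lemma ex_pr: obtains x y where "x \<noteq> 0 \<or> y \<noteq> 0" "s = pr x y"
proof (cases s)
  case None then show ?thesis using that[of 1 0] by (simp add: pr_def)
next
  case (Some z) then show ?thesis using that[of z 1] by (simp add: pr_def)
qed

text \<open>The action on the projective line of the matrix with rows (a, b) and (c, d).\<close>

definition mob :: "complex \<Rightarrow> complex \<Rightarrow> complex \<Rightarrow> complex \<Rightarrow> sphere \<Rightarrow> sphere" where
  "mob a b c d s = (case s of None \<Rightarrow> pr a c | Some z \<Rightarrow> pr (a * z + b) (c * z + d))"

text \<open>Applying the adjugate matrix to the image vector returns the determinant times (x,
  y).\<close>

lemma mob_nondegenerate:
  fixes a b c d :: complex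
  assumes "a * d - b * c \<noteq> 0" "x \<noteq> 0 \<or> y \<noteq> 0"
  shows "a * x + b * y \<noteq> 0 \<or> c * x + d * y \<noteq> 0"
proof (rule ccontr)
  assume "\<not> ?thesis"
  then have z: "a * x + b * y = 0" "c * x + d * y = 0" by auto
  have "(a * d - b * c) * x = d * (a * x + b * y) - b * (c * x + d * y)"
    "(a * d - b * c) * y = a * (c * x + d * y) - c * (a * x + b * y)"
    by (simp_all add: algebra_simps)
  then show False using z assms by auto
qed

lemma pr_scale: "t \<noteq> 0 \<Longrightarrow> pr (t * x) (t * y) = pr x y"
  by (simp add: pr_def)

lemma mob_pr:
  assumes "a * d - b * c \<noteq> 0" "x \<noteq> 0 \<or> y \<noteq> 0"
  shows "mob a b c d (pr x y) = pr (a * x + b * y) (c * x + d * y)"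
proof (cases "y = 0")
  case True
  then have "x \<noteq> 0" using assms by auto
  then show ?thesis using True pr_scale[of x a c] by (simp add: mob_def pr_def mult.commute)
next
  case False
  have "pr (y * (a * (x / y) + b)) (y * (c * (x / y) + d)) = pr (a * (x / y) + b) (c * (x / y) + d)"
    by (rule pr_scale) fact
  moreover have "y * (a * (x / y) + b) = a * x + b * y" "y * (c * (x / y) + d) = c * x + d * y"
    using False by (simp_all add: field_simps)
  ultimately have "pr (a * (x / y) + b) (c * (x / y) + d) = pr (a * x + b * y) (c * x + d * y)"
    by (simp only:)
  then show ?thesis using False by (simp add: mob_def pr_def[of x y])
qed

lemma mob_comp:
  assumes "a * d - b * c \<noteq> 0" "a' * d' - b' * c' \<noteq> 0"
  shows "mob a b c d \<circ> mob a' b' c' d' =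
    mob (a * a' + b * c') (a * b' + b * d') (c * a' + d * c') (c * b' + d * d')"
    "(a * a' + b * c') * (c * b' + d * d') - (a * b' + b * d') * (c * a' + d * c') \<noteq> 0"
proof -
  have eq: "(a * a' + b * c') * (c * b' + d * d') - (a * b' + b * d') * (c * a' + d * c')
    = (a * d - b * c) * (a' * d' - b' * c')" by (simp add: algebra_simps)
  show nz: "(a * a' + b * c') * (c * b' + d * d') - (a * b' + b * d') * (c * a' + d * c') \<noteq> 0"
    unfolding eq using assms by simp
  show "mob a b c d \<circ> mob a' b' c' d' =
    mob (a * a' + b * c') (a * b' + b * d') (c * a' + d * c') (c * b' + d * d')"
  proof
    fix s
    obtain x y where s: "x \<noteq> 0 \<or> y \<noteq> 0" "s = pr x y" by (rule ex_pr)
    show "(mob a b c d \<circ> mob a' b' c' d') s =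
      mob (a * a' + b * c') (a * b' + b * d') (c * a' + d * c') (c * b' + d * d') s"
      unfolding s(2) o_apply mob_pr[OF assms(2) s(1)] mob_pr[OF nz s(1)]
        mob_pr[OF assms(1) mob_nondegenerate[OF assms(2) s(1)]]
      by (simp add: algebra_simps)
  qed
qed

lemma mob_scalar: "a \<noteq> 0 \<Longrightarrow> mob a 0 0 a = id"
  by (auto simp: fun_eq_iff mob_def pr_def split: option.splits)

text \<open>With determinant 0 the two polynomials are proportional, so a nonconstant one of them is
  a common divisor up to a scalar. Conversely, a constant combination of the two equals the
  determinant up to sign.\<close>

lemma coprime_linear_iff:
  fixes a b c d :: complex
  assumes "max (degree [:b, a:]) (degree [:d, c:]) = 1"
  shows "coprime [:b, a:] [:d, c:] \<longleftrightarrow> a * d - b * c \<noteq> 0"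
proof
  assume cop: "coprime [:b, a:] [:d, c:]"
  show "a * d - b * c \<noteq> 0"
  proof
    assume det: "a * d - b * c = 0"
    have e: "smult c [:b, a:] = smult a [:d, c:]" using det by (simp add: algebra_simps)
    have ac: "a \<noteq> 0 \<or> c \<noteq> 0" using assms by (auto split: if_splits)
    have du: "degree p = 0" if "is_unit p" for p :: "complex poly" using that by (auto elim: is_unit_polyE)
    consider "a \<noteq> 0" | "a = 0" "c \<noteq> 0" using ac by blast
    then show False
    proof cases
      case 1
      have "[:b, a:] dvd smult a [:d, c:]" unfolding e[symmetric] by (rule dvd_smult) simp
      then have "[:b, a:] dvd [:d, c:]" using 1 by (rule dvd_smult_cancel)
      then have "is_unit [:b, a:]" using cop by (meson coprime_common_divisor dvd_refl)
      from du[OF this] 1 show False by simp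
    next
      case 2
      then have "b = 0" using det by simp
      then have "is_unit [:d, c:]" using cop 2 by simp
      from du[OF this] 2 show False by simp
    qed
  qed
next
  assume det: "a * d - b * c \<noteq> 0"
  show "coprime [:b, a:] [:d, c:]"
  proof (rule coprimeI)
    fix r assume r: "r dvd [:b, a:]" "r dvd [:d, c:]"
    have "r dvd smult c [:b, a:] - smult a [:d, c:]" by (intro dvd_diff dvd_smult r)
    moreover have "smult c [:b, a:] - smult a [:d, c:] = [: - (a * d - b * c) :]"
      by (simp add: algebra_simps)
    ultimately have "r dvd [: - (a * d - b * c) :]" by (simp add: mult.commute[of c b])
    moreover have "is_unit [: - (a * d - b * c) :]" by (rule is_unit_triv) (use det in simp)
    ultimately show "is_unit r" using dvd_trans by blast
  qed
qed

lemma rat_map_of_linear: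
  assumes "a * d - b * c \<noteq> 0"
  shows "rat_map_of [:b, a:] [:d, c:] = mob a b c d"
proof
  fix s show "rat_map_of [:b, a:] [:d, c:] s = mob a b c d s"
  proof (cases s)
    case None
    show ?thesis
    proof (cases "c = 0")
      case True
      then have "a \<noteq> 0" using assms by auto
      then show ?thesis using True None by (simp add: rat_map_of_def mob_def pr_def)
    next
      case False
      then show ?thesis using None by (simp add: rat_map_of_def mob_def pr_def)
    qed
  next
    case (Some z)
    then show ?thesis by (simp add: rat_map_of_def mob_def pr_def mult.commute add.commute)
  qed
qed

lemma degree_le_1_eq: "degree p \<le> 1 \<Longrightarrow> p = [:coeff p 0, coeff p 1:]"
  by (rule poly_eqI) (auto simp: coeff_pCons coeff_eq_0 split: nat.splits)

lemma is_mobius_iff: "is_mobius \<tau> \<longleftrightarrow> (\<exists>a b c d. a * d - b * c \<noteq> 0 \<and> \<tau> = mob a b c d)"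
proof
  assume "is_mobius \<tau>"
  then obtain p q where pq: "q \<noteq> 0" "coprime p q" "max (degree p) (degree q) = 1" "\<tau> = rat_map_of p q"
    by (auto simp: is_mobius_def is_rat_map_def)
  obtain a b c d where p: "p = [:b, a:]" and q: "q = [:d, c:]"
    using degree_le_1_eq[of p] degree_le_1_eq[of q] pq(3) by (metis max.cobounded1 max.cobounded2)
  have det: "a * d - b * c \<noteq> 0" using coprime_linear_iff[of b a d c] pq unfolding p q by blast
  then show "\<exists>a b c d. a * d - b * c \<noteq> 0 \<and> \<tau> = mob a b c d"
    using rat_map_of_linear[OF det] pq(4) p q by auto
next
  assume "\<exists>a b c d. a * d - b * c \<noteq> 0 \<and> \<tau> = mob a b c d"
  then obtain a b c d where *: "a * d - b * c \<noteq> 0" "\<tau> = mob a b c d" by blast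
  have m: "max (degree [:b, a:]) (degree [:d, c:]) = 1" using *(1) by auto
  then show "is_mobius \<tau>" unfolding is_mobius_def is_rat_map_def
    using coprime_linear_iff[OF m] rat_map_of_linear[OF *(1)] *
    by (intro exI[of _ "[:b, a:]"] exI[of _ "[:d, c:]"]) auto
qed

lemma is_mobiusE:
  assumes "is_mobius \<tau>"
  obtains a b c d where "a * d - b * c \<noteq> 0" "\<tau> = mob a b c d"
  using assms is_mobius_iff by auto

lemma is_mobius_mob: "a * d - b * c \<noteq> 0 \<Longrightarrow> is_mobius (mob a b c d)"
  using is_mobius_iff by auto

section \<open>The group of Moebius transformations\<close>

lemma is_mobius_id: "is_mobius id"
  using is_mobius_mob[of 1 1 0 0] mob_scalar[of 1] by simp

lemma is_mobius_comp: "is_mobius s \<Longrightarrow> is_mobius t \<Longrightarrow> is_mobius (s \<circ> t)"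
  by (metis is_mobius_iff mob_comp)

lemma is_mobius_funpow: "is_mobius s \<Longrightarrow> is_mobius (s ^^ n)"
  by (induction n) (auto simp: is_mobius_id is_mobius_comp)

abbreviation sinv :: "(sphere \<Rightarrow> sphere) \<Rightarrow> sphere \<Rightarrow> sphere" where "sinv \<equiv> inv_into UNIV"

lemma is_mobius_inverse:
  assumes "is_mobius s"
  shows "bij s" "is_mobius (sinv s)"
proof -
  obtain a b c d where *: "a * d - b * c \<noteq> 0" "s = mob a b c d" using assms by (rule is_mobiusE)
  have 1: "d * a - (- b) * (- c) \<noteq> 0" using * by (simp add: algebra_simps)
  have "s \<circ> mob d (- b) (- c) a = id"
    unfolding *(2) mob_comp[OF *(1) 1] using mob_scalar[OF *(1)] by (simp add: algebra_simps)
  moreover have "mob d (- b) (- c) a \<circ> s = id"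
    unfolding *(2) mob_comp[OF 1 *(1)] using mob_scalar[OF *(1)] by (simp add: algebra_simps)
  ultimately show "bij s" "is_mobius (sinv s)"
    using is_mobius_mob[OF 1] by (auto simp: o_bij inv_unique_comp)
qed

lemma mobius_inv_simps:
  assumes "is_mobius s"
  shows "s (sinv s x) = x" "sinv s (s x) = x" "sinv s \<circ> s = id" "s \<circ> sinv s = id" "s x = s y \<longleftrightarrow> x = y"
  using is_mobius_inverse(1)[OF assms]
  by (auto simp: fun_eq_iff bij_is_surj surj_f_inv_f bij_is_inj inv_f_f inj_eq)

section \<open>Binary quadratic forms and fixed points of Moebius transformations\<close>

lemma quadratic_form_zero:
  fixes a b c :: complex
  obtains x y where "x \<noteq> 0 \<or> y \<noteq> 0" "a * x^2 + b * x * y + c * y^2 = 0"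
proof (cases "a = 0")
  case True then show ?thesis using that[of 1 0] by simp
next
  case False
  define r where "r = csqrt (b^2 - 4 * a * c)"
  have r: "r^2 = b^2 - 4 * a * c" by (simp add: r_def)
  have "a * (r - b)^2 + b * (r - b) * (2 * a) + c * (2 * a)^2 = a * (r^2 - (b^2 - 4 * a * c))"
    by (simp add: algebra_simps power2_eq_square)
  then show ?thesis using that[of "r - b" "2 * a"] r False by simp
qed

text \<open>A binary quadratic form of discriminant 0 is the square of a linear form.\<close>

lemma quadratic_form_square:
  fixes a b c :: complex
  assumes "b^2 = 4 * a * c"
  obtains l m where "a = l^2" "b = 2 * l * m" "c = m^2"
proof (cases "a = 0")
  case True
  then show ?thesis using that[of 0 "csqrt c"] assms by simp
next
  case False
  define l where "l = csqrt a"
  have l: "l^2 = a" "l \<noteq> 0" using False by (auto simp: l_def)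
  have "(b / (2 * l))^2 = c"
    using assms l False by (simp add: power_divide power_mult_distrib)
  then show ?thesis using that[of l "b / (2 * l)"] l by simp
qed

text \<open>In homogeneous coordinates the fixed points are the zeros of the form c x^2 + (d - a) x
  y - b y^2.\<close>

lemma mobius_fixed_point:
  assumes "is_mobius s" obtains x where "s x = x"
proof -
  obtain a b c d where *: "a * d - b * c \<noteq> 0" "s = mob a b c d" using assms by (rule is_mobiusE)
  obtain x y where xy: "x \<noteq> 0 \<or> y \<noteq> 0" "c * x^2 + (d - a) * x * y + (- b) * y^2 = 0"
    by (rule quadratic_form_zero)
  have "s (pr x y) = pr x y"
    using mob_nondegenerate[OF *(1) xy(1)] xy
    by (simp add: *(2) mob_pr[OF *(1) xy(1)] pr_eq_iff algebra_simps power2_eq_square)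
  then show ?thesis using that by blast
qed

text \<open>The bound 3 counts infinity besides the at most two finite roots. It is not sharp, but
  fibres with at least 4 points suffice in \<open>deck_order\<close>.\<close>

lemma mobius_fixed_points:
  assumes "is_mobius s" "s \<noteq> id"
  shows "finite {x. s x = x}" "card {x. s x = x} \<le> 3"
proof -
  obtain a b c d where *: "a * d - b * c \<noteq> 0" "s = mob a b c d" using assms(1) by (rule is_mobiusE)
  let ?q = "[:- b, d - a, c:]"
  have nz: "?q \<noteq> 0"
  proof
    assume "?q = 0"
    then have "b = 0" "c = 0" "d = a" by auto
    then show False using * assms(2) mob_scalar[of a] by auto
  qed
  have sub: "{x. s x = x} \<subseteq> insert None (Some ` {z. poly ?q z = 0})"
  proof
    fix x assume x: "x \<in> {x. s x = x}"
    show "x \<in> insert None (Some ` {z. poly ?q z = 0})"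
    proof (cases x)
      case (Some z)
      then have "Some z = pr (a * z + b) (c * z + d)" using x by (simp add: * mob_def)
      then have "z * (c * z + d) = a * z + b" by (auto simp: pr_def field_simps split: if_splits)
      then have "poly ?q z = 0" by (simp add: algebra_simps)
      then show ?thesis using Some by auto
    qed simp
  qed
  have fin: "finite (insert None (Some ` {z. poly ?q z = 0}))"
    using poly_roots_finite[OF nz] by simp
  show "finite {x. s x = x}" by (rule finite_subset[OF sub fin])
  have "card (insert None (Some ` {z. poly ?q z = 0})) \<le> Suc (card (Some ` {z. poly ?q z = 0}))"
    by (rule card_insert_le_m1) auto
  also have "\<dots> \<le> Suc (card {z. poly ?q z = 0})"
    using card_image_le[OF poly_roots_finite[OF nz], of Some] by (simp only: Suc_le_mono)
  also have "card {z. poly ?q z = 0} \<le> 2"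
    using card_poly_roots_bound[OF nz] by (rule order_trans) simp
  finally show "card {x. s x = x} \<le> 3" using card_mono[OF fin sub] by simp
qed

section \<open>Quadratic rational maps are Moebius equivalent to squaring\<close>

definition sq :: "sphere \<Rightarrow> sphere" where "sq = map_option (\<lambda>z. z^2)"

lemma sq_pr: "sq (pr x y) = pr (x^2) (y^2)"
  by (simp add: sq_def pr_def power_divide)

definition neg :: "sphere \<Rightarrow> sphere" where "neg = map_option uminus"

lemma neg_eq_mob: "neg = mob (-1) 0 0 1"
  by (auto simp: fun_eq_iff neg_def mob_def pr_def split: option.splits)

lemma is_mobius_neg: "is_mobius neg"
  unfolding neg_eq_mob by (rule is_mobius_mob) simp

lemma neg_neg [simp]: "neg (neg x) = x" "neg \<circ> neg = id"
  by (auto simp: neg_def option.map_comp o_def option.map_ident fun_eq_iff)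

lemma sq_neg: "sq (neg x) = sq x"
  by (simp add: sq_def neg_def option.map_comp o_def)

lemma sq_eq_iff: "sq x = sq y \<longleftrightarrow> x = y \<or> x = neg y"
  by (cases x; cases y) (auto simp: sq_def neg_def power2_eq_iff)

lemma surj_sq: "\<exists>x. sq x = y"
proof (cases y)
  case None then show ?thesis by (intro exI[of _ None]) (simp add: sq_def)
next
  case (Some z) then show ?thesis by (intro exI[of _ "Some (csqrt z)"]) (simp add: sq_def)
qed

abbreviation crit :: "sphere set" where "crit \<equiv> {Some 0, None}"

lemma neg_eq_self_iff: "neg x = x \<longleftrightarrow> x \<in> crit"
  by (cases x) (auto simp: neg_def)

text \<open>Both polynomials are homogenised to degree 2. A common zero of the forms is excluded at
  finite points by coprimality, and at infinity because one of the degrees is exactly 2.\<close>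

lemma rat_map_2_pr:
  assumes "q \<noteq> 0" "coprime p q" "max (degree p) (degree q) = 2" "x \<noteq> 0 \<or> y \<noteq> 0"
  defines "X \<equiv> coeff p 2 * x^2 + coeff p 1 * x * y + coeff p 0 * y^2"
    and "Y \<equiv> coeff q 2 * x^2 + coeff q 1 * x * y + coeff q 0 * y^2"
  shows "rat_map_of p q (pr x y) = pr X Y" "X \<noteq> 0 \<or> Y \<noteq> 0"
proof -
  have dp: "degree p \<le> 2" "degree q \<le> 2" using assms(3) by auto
  have c: "poly r z = coeff r 2 * z^2 + coeff r 1 * z + coeff r 0" if "degree r \<le> 2" for r :: "complex poly" and z
  proof -
    have "poly r z = (\<Sum>i\<le>degree r. coeff r i * z^i)" by (rule poly_altdef)
    also have "\<dots> = (\<Sum>i\<le>2. coeff r i * z^i)"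
      by (rule sum.mono_neutral_left) (use that in \<open>auto simp: coeff_eq_0\<close>)
    also have "\<dots> = coeff r 2 * z^2 + coeff r 1 * z + coeff r 0" by (simp add: numeral_2_eq_2)
    finally show ?thesis .
  qed
  show "rat_map_of p q (pr x y) = pr X Y"
  proof (cases "y = 0")
    case True
    then have x: "x \<noteq> 0" using assms by auto
    have pe: "pr X Y = pr (coeff p 2) (coeff q 2)" using x True pr_scale[of "x^2" "coeff p 2" "coeff q 2"]
      by (simp add: X_def Y_def mult.commute)
    show ?thesis
    proof (cases "coeff q 2 = 0")
      case t: True
      then have "degree q \<noteq> 2" using assms(1) by (metis leading_coeff_0_iff)
      then have "degree q < degree p" using assms(3) by auto
      then show ?thesis unfolding pe using t True by (simp add: rat_map_of_def pr_def)
    next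
      case False
      then have dq: "degree q = 2" using dp le_degree[of q 2] by simp
      then have "\<not> degree q < degree p" using dp by simp
      then show ?thesis unfolding pe using False True by (simp add: rat_map_of_def pr_def dq)
    qed
  next
    case False
    have X: "X = y^2 * poly p (x / y)" "Y = y^2 * poly q (x / y)"
      unfolding c[OF dp(1)] c[OF dp(2)] using False by (simp_all add: X_def Y_def field_simps power2_eq_square)
    have "pr X Y = pr (poly p (x / y)) (poly q (x / y))"
      unfolding X by (rule pr_scale) (use False in simp)
    then show ?thesis using False by (simp add: rat_map_of_def pr_def)
  qed
  show "X \<noteq> 0 \<or> Y \<noteq> 0"
  proof (cases "y = 0")
    case True
    then have x: "x \<noteq> 0" using assms by auto
    show ?thesis
    proof (rule ccontr)
      assume "\<not> ?thesis"
      then have z: "coeff p 2 = 0" "coeff q 2 = 0" using x True by (auto simp: X_def Y_def)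
      then have "degree p \<noteq> 2" "degree q \<noteq> 2" by (metis leading_coeff_0_iff degree_0 zero_neq_numeral)+
      then show False using assms(3) by (auto simp: max_def split: if_splits)
    qed
  next
    case False
    have X: "X = y^2 * poly p (x / y)" "Y = y^2 * poly q (x / y)"
      unfolding c[OF dp(1)] c[OF dp(2)] using False by (simp_all add: X_def Y_def field_simps power2_eq_square)
    have "\<not> (poly p (x/y) = 0 \<and> poly q (x/y) = 0)"
      using coprime_poly_0[OF assms(2)] by blast
    then show ?thesis using X False by auto
  qed
qed

text \<open>The pencil spanned by numerator and denominator contains two independent squares of
  linear forms, one for each critical value. Taking these squares as new coordinates in the target
  gives A, and taking the linear forms as coordinates in the source gives B.\<close>

lemma quadratic_map_normal_form:
  assumes "is_rat_map f 2"
  obtains A B where "is_mobius A" "is_mobius B" "f = A \<circ> sq \<circ> B"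
proof -
  obtain p q where pq: "q \<noteq> 0" "coprime p q" "max (degree p) (degree q) = 2" "f = rat_map_of p q"
    using assms by (auto simp: is_rat_map_def)
  define P where "P x y = coeff p 2 * x^2 + coeff p 1 * x * y + coeff p 0 * y^2" for x y
  define Q where "Q x y = coeff q 2 * x^2 + coeff q 1 * x * y + coeff q 0 * y^2" for x y
  have f: "f (pr x y) = pr (P x y) (Q x y)" "P x y \<noteq> 0 \<or> Q x y \<noteq> 0" if "x \<noteq> 0 \<or> y \<noteq> 0" for x y
    using rat_map_2_pr[OF pq(1-3) that] by (auto simp: pq(4) P_def Q_def)
  \<comment> \<open>The discriminant of a member of the pencil spanned by P and Q is a quadratic form
    in the coefficients, so it vanishes somewhere.\<close>
  obtain g d where gd: "g \<noteq> 0 \<or> d \<noteq> 0" and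
    "((coeff p 1)^2 - 4 * coeff p 2 * coeff p 0) * g^2
      + (2 * coeff p 1 * coeff q 1 - 4 * coeff p 2 * coeff q 0 - 4 * coeff q 2 * coeff p 0) * g * d
      + ((coeff q 1)^2 - 4 * coeff q 2 * coeff q 0) * d^2 = 0"
    by (rule quadratic_form_zero)
  then have "(g * coeff p 1 + d * coeff q 1)^2
    = 4 * (g * coeff p 2 + d * coeff q 2) * (g * coeff p 0 + d * coeff q 0)"
    by (simp add: algebra_simps power2_eq_square)
  then obtain l m where lm: "g * coeff p 2 + d * coeff q 2 = l^2"
    "g * coeff p 1 + d * coeff q 1 = 2 * l * m" "g * coeff p 0 + d * coeff q 0 = m^2"
    by (rule quadratic_form_square)
  have Q': "g * P x y + d * Q x y = (l * x + m * y)^2" for x y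
  proof -
    have "g * P x y + d * Q x y = (g * coeff p 2 + d * coeff q 2) * x^2
      + (g * coeff p 1 + d * coeff q 1) * x * y + (g * coeff p 0 + d * coeff q 0) * y^2"
      by (simp add: P_def Q_def algebra_simps)
    then show ?thesis unfolding lm by (simp add: algebra_simps power2_eq_square)
  qed
  \<comment> \<open>The row (g, d) is completed to an invertible matrix, so that the first square
    and another form span the pencil.\<close>
  obtain a b where ab: "a * d - b * g \<noteq> 0"
  proof (cases "d = 0")
    case True then show ?thesis using that[of 0 1] gd by auto
  next
    case False then show ?thesis using that[of 1 0] by auto
  qed
  have PQ: "a * P x y + b * Q x y \<noteq> 0 \<or> (l * x + m * y)^2 \<noteq> 0" if "x \<noteq> 0 \<or> y \<noteq> 0" for x y
    using mob_nondegenerate[OF ab f(2)[OF that]] unfolding Q' .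
  define p2 p1 p0 where ps: "p2 = a * coeff p 2 + b * coeff q 2" "p1 = a * coeff p 1 + b * coeff q 1"
    "p0 = a * coeff p 0 + b * coeff q 0"
  have P': "a * P x y + b * Q x y = p2 * x^2 + p1 * x * y + p0 * y^2" for x y
    by (simp add: P_def Q_def ps algebra_simps)
  have "l \<noteq> 0 \<or> m \<noteq> 0"
  proof (rule ccontr)
    assume n: "\<not> ?thesis"
    obtain x y where "x \<noteq> 0 \<or> y \<noteq> 0" "p2 * x^2 + p1 * x * y + p0 * y^2 = 0"
      by (rule quadratic_form_zero)
    then show False using PQ[of x y] n unfolding P' by simp
  qed
  then have nz: "p2 * m^2 - p1 * l * m + p0 * l^2 \<noteq> 0"
    using PQ[of m "-l"] unfolding P' by (auto simp: algebra_simps)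
  \<comment> \<open>Adding e times the first square changes the discriminant of the other form by an
    affine function of e. Its slope is -4 times the value of that form at (m, -l), the zero of the
    first square, and is nonzero because the forms have no common zero. This e is the root.\<close>
  define e where "e = (p1^2 - 4 * p2 * p0) / (4 * (p2 * m^2 - p1 * l * m + p0 * l^2))"
  have e: "4 * e * (p2 * m^2 - p1 * l * m + p0 * l^2) = p1^2 - 4 * p2 * p0"
  proof -
    have "4 * (R / (4 * N)) * N = R" if "N \<noteq> 0" for R N :: complex using that by simp
    from this[OF nz] show ?thesis unfolding e_def .
  qed
  have "(p1 + 2 * e * l * m)^2 - 4 * (p2 + e * l^2) * (p0 + e * m^2)
    = (p1^2 - 4 * p2 * p0) - 4 * e * (p2 * m^2 - p1 * l * m + p0 * l^2)"
    by (simp add: algebra_simps power2_eq_square)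
  then have "(p1 + 2 * e * l * m)^2 = 4 * (p2 + e * l^2) * (p0 + e * m^2)"
    using e by simp
  then obtain l' m' where lm': "p2 + e * l^2 = l'^2" "p1 + 2 * e * l * m = 2 * l' * m'" "p0 + e * m^2 = m'^2"
    by (rule quadratic_form_square)
  have P'': "(a * P x y + b * Q x y) + e * (g * P x y + d * Q x y) = (l' * x + m' * y)^2" for x y
  proof -
    have "(a * P x y + b * Q x y) + e * (g * P x y + d * Q x y)
      = (p2 + e * l^2) * x^2 + (p1 + 2 * e * l * m) * x * y + (p0 + e * m^2) * y^2"
      unfolding P' Q' by (simp add: algebra_simps power2_eq_square)
    then show ?thesis unfolding lm' by (simp add: algebra_simps power2_eq_square)
  qed
  \<comment> \<open>At (m, -l) the first square vanishes, and the second one is the square of the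
    determinant of the two linear forms.\<close>
  have "(l' * m - m' * l)^2 = p2 * m^2 - p1 * l * m + p0 * l^2"
    using P''[of m "-l"] unfolding P' Q' by (simp add: algebra_simps)
  then have detB: "l' * m - m' * l \<noteq> 0" using nz by auto
  have detA: "(a + e * g) * d - (b + e * d) * g \<noteq> 0" using ab by (simp add: algebra_simps)
  define A B where "A = mob (a + e * g) (b + e * d) g d" and "B = mob l' m' l m"
  have AB: "is_mobius A" "is_mobius B" unfolding A_def B_def using detA detB by (auto intro: is_mobius_mob)
  have "A \<circ> f = sq \<circ> B"
  proof
    fix s
    obtain x y where s: "x \<noteq> 0 \<or> y \<noteq> 0" "s = pr x y" by (rule ex_pr)
    have "A (f s) = pr ((a + e * g) * P x y + (b + e * d) * Q x y) (g * P x y + d * Q x y)"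
      unfolding A_def s(2) f(1)[OF s(1)] by (rule mob_pr[OF detA f(2)[OF s(1)]])
    also have "(a + e * g) * P x y + (b + e * d) * Q x y = (l' * x + m' * y)^2"
      unfolding P''[symmetric] by (simp add: algebra_simps)
    also have "pr ((l' * x + m' * y)^2) (g * P x y + d * Q x y) = sq (B s)"
      unfolding B_def s(2) mob_pr[OF detB s(1)] sq_pr Q' ..
    finally show "(A \<circ> f) s = (sq \<circ> B) s" by simp
  qed
  then have "f = sinv A \<circ> sq \<circ> B"
    by (metis AB(1) mobius_inv_simps(3) comp_assoc id_comp)
  then show ?thesis using that[of "sinv A" B] AB is_mobius_inverse(2) by blast
qed

section \<open>Neighbourhoods and local degree\<close>

text \<open>Neighbourhoods in the quotient topology of the projective line, pushed forward from one
  representative in C^2. By \<open>nb_pr\<close> the choice of representative is immaterial.\<close>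

definition nb :: "sphere \<Rightarrow> sphere filter" where
  "nb s = filtermap (case_prod pr) (nhds (case s of None \<Rightarrow> (1, 0) | Some z \<Rightarrow> (z, 1)))"

lemma eventually_nhds_nonzero:
  assumes "(x, y) \<noteq> (0 :: complex, 0 :: complex)"
  shows "eventually (\<lambda>u. u \<noteq> (0, 0)) (nhds (x, y))"
  by (rule t1_space_nhds) (use assms in simp)

text \<open>Division by t is continuous on C^2 and does not change the projected point.\<close>

lemma filtermap_pr_nhds_le:
  assumes t: "t \<noteq> 0"
  shows "filtermap (case_prod pr) (nhds (t * x, t * y)) \<le> filtermap (case_prod pr) (nhds (x, y))"
proof -
  have "((\<lambda>u. (fst u / t, snd u / t)) \<longlongrightarrow> (t * x / t, t * y / t)) (nhds (t * x, t * y))"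
    using t by (intro tendsto_intros filterlim_ident tendsto_fst[of _ "(t * x, t * y)", simplified]
        tendsto_snd[of _ "(t * x, t * y)", simplified])
  then have "filterlim (\<lambda>u. (fst u / t, snd u / t)) (nhds (x, y)) (nhds (t * x, t * y))"
    using t by simp
  then have "filterlim (\<lambda>u. case_prod pr (fst u / t, snd u / t))
      (filtermap (case_prod pr) (nhds (x, y))) (nhds (t * x, t * y))"
    by (rule filterlim_compose[rotated]) (simp add: filterlim_def)
  moreover have "(\<lambda>u. case_prod pr (fst u / t, snd u / t)) = case_prod pr"
    using t by (auto simp: fun_eq_iff pr_def)
  ultimately show ?thesis by (simp add: filterlim_def)
qed

lemma nb_pr:
  assumes "x \<noteq> 0 \<or> y \<noteq> 0"
  shows "nb (pr x y) = filtermap (case_prod pr) (nhds (x, y))"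
proof -
  have sc: "filtermap (case_prod pr) (nhds (t * x, t * y)) = filtermap (case_prod pr) (nhds (x, y))"
    if t: "t \<noteq> 0" for t
    using filtermap_pr_nhds_le[OF t, of x y] filtermap_pr_nhds_le[of "1 / t" "t * x" "t * y"] t
    by (intro antisym) auto
  show ?thesis
  proof (cases "y = 0")
    case True
    then show ?thesis using sc[of "1 / x"] assms by (simp add: nb_def pr_def)
  next
    case False
    then show ?thesis using sc[of "1 / y"] assms by (simp add: nb_def pr_def)
  qed
qed

text \<open>Continuity of F follows from that of a lift h to C^2. The lift needs to represent F only
  away from the origin, which is the case near any representative.\<close>

lemma filterlim_nbI:
  assumes "x \<noteq> 0 \<or> y \<noteq> 0" "h (x, y) \<noteq> (0, 0)" "filterlim h (nhds (h (x, y))) (nhds (x, y))"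
    and eq: "\<And>x y. x \<noteq> 0 \<or> y \<noteq> 0 \<Longrightarrow> F (pr x y) = case_prod pr (h (x, y))"
  shows "filterlim F (nb (F (pr x y))) (nb (pr x y))"
proof -
  have "filterlim (\<lambda>u. case_prod pr (h u)) (filtermap (case_prod pr) (nhds (h (x, y)))) (nhds (x, y))"
    by (rule filterlim_compose[OF _ assms(3)]) (simp add: filterlim_def)
  moreover have "filtermap (case_prod pr) (nhds (h (x, y))) = nb (F (pr x y))"
    unfolding eq[OF assms(1)] using nb_pr[of "fst (h (x, y))" "snd (h (x, y))"] assms(2)
    by (cases "h (x, y)") auto
  ultimately have lim: "filterlim (\<lambda>u. case_prod pr (h u)) (nb (F (pr x y))) (nhds (x, y))" by simp
  have ev: "eventually (\<lambda>u. case_prod pr (h u) = F (case_prod pr u)) (nhds (x, y))"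
  proof (rule eventually_mono[OF eventually_nhds_nonzero[of x y]])
    fix u :: "complex \<times> complex" assume "u \<noteq> (0, 0)"
    then show "case_prod pr (h u) = F (case_prod pr u)" using eq[of "fst u" "snd u"] by (cases u) auto
  qed (use assms(1) in auto)
  have "filterlim (\<lambda>u. F (case_prod pr u)) (nb (F (pr x y))) (nhds (x, y))"
    by (rule iffD1[OF filterlim_cong[OF refl refl ev] lim])
  then show ?thesis unfolding nb_pr[OF assms(1)] by (simp add: filterlim_filtermap)
qed

definition cont :: "(sphere \<Rightarrow> sphere) \<Rightarrow> bool" where
  "cont F \<longleftrightarrow> (\<forall>x. filterlim F (nb (F x)) (nb x))"

lemma cont_mobius:
  assumes "is_mobius s" shows "cont s"
  unfolding cont_def
proof
  fix w
  obtain a b c d where *: "a * d - b * c \<noteq> 0" "s = mob a b c d" using assms by (rule is_mobiusE)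
  obtain x y where w: "x \<noteq> 0 \<or> y \<noteq> 0" "w = pr x y" by (rule ex_pr)
  let ?h = "\<lambda>u. (a * fst u + b * snd u, c * fst u + d * snd u)"
  have "(?h \<longlongrightarrow> ?h (x, y)) (nhds (x, y))"
    by (intro tendsto_intros filterlim_ident tendsto_fst[of _ "(x, y)", simplified]
        tendsto_snd[of _ "(x, y)", simplified])
  then show "filterlim s (nb (s w)) (nb w)"
    unfolding w(2) using mob_nondegenerate[OF *(1) w(1)]
    by (intro filterlim_nbI[OF w(1), of ?h]) (auto simp: *(2) mob_pr[OF *(1)])
qed

lemma cont_sq: "cont sq"
  unfolding cont_def
proof
  fix w
  obtain x y where w: "x \<noteq> 0 \<or> y \<noteq> 0" "w = pr x y" by (rule ex_pr)
  let ?h = "\<lambda>u. ((fst u)^2, (snd u)^2) :: complex \<times> complex"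
  have "(?h \<longlongrightarrow> ?h (x, y)) (nhds (x, y))"
    by (intro tendsto_intros filterlim_ident tendsto_fst[of _ "(x, y)", simplified]
        tendsto_snd[of _ "(x, y)", simplified])
  then show "filterlim sq (nb (sq w)) (nb w)"
    unfolding w(2) using w(1)
    by (intro filterlim_nbI[OF w(1), of ?h]) (auto simp: sq_pr)
qed

lemma cont_eventually: "cont F \<Longrightarrow> eventually P (nb (F x)) \<Longrightarrow> eventually (\<lambda>z. P (F z)) (nb x)"
  by (auto simp: cont_def filterlim_iff)

lemma cont_comp: "cont F \<Longrightarrow> cont H \<Longrightarrow> cont (H \<circ> F)"
  by (auto simp: cont_def o_def intro: filterlim_compose)

text \<open>The charts z to (z, 1) and (x, y) to x / y are continuous in the two directions.\<close>

lemma nb_Some: "nb (Some a) = filtermap Some (nhds a)"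
proof (rule antisym)
  have "eventually (\<lambda>u. snd u \<noteq> 0) (nhds (a, 1 :: complex))"
    using tendsto_snd[of "\<lambda>x. x" "(a, 1)" "nhds (a, 1)"]
    by (intro tendsto_imp_eventually_ne[of _ 1]) (auto simp: filterlim_ident)
  then have ev: "eventually (\<lambda>u. Some (fst u / snd u) = case_prod pr u) (nhds (a, 1 :: complex))"
    by (rule eventually_mono) (auto simp: pr_def)
  have "((\<lambda>u. fst u / snd u) \<longlongrightarrow> a / 1) (nhds (a, 1))"
    by (intro tendsto_intros filterlim_ident tendsto_fst[of _ "(a, 1)", simplified]
        tendsto_snd[of _ "(a, 1)", simplified]) simp_all
  then have "filterlim (\<lambda>u. Some (fst u / snd u)) (filtermap Some (nhds a)) (nhds (a, 1 :: complex))"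
    by (intro filterlim_compose[where g = Some and f = "\<lambda>u. fst u / snd u" and ?F2.0 = "nhds a"])
      (simp_all add: filterlim_def)
  then have "filterlim (case_prod pr) (filtermap Some (nhds a)) (nhds (a, 1))"
    by (rule iffD1[OF filterlim_cong[OF refl refl ev]])
  then show "nb (Some a) \<le> filtermap Some (nhds a)" by (simp add: nb_def filterlim_def)
  have "((\<lambda>z. (z, 1 :: complex)) \<longlongrightarrow> (a, 1)) (nhds a)" by (intro tendsto_intros filterlim_ident)
  then have "filterlim (\<lambda>z. case_prod pr (z, 1)) (nb (Some a)) (nhds a)"
    by (rule filterlim_compose[of "case_prod pr" "nb (Some a)" "nhds (a, 1)", rotated])
      (simp_all add: filterlim_def nb_def)
  then show "filtermap Some (nhds a) \<le> nb (Some a)" by (simp add: pr_def filterlim_def)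
qed

lemma mobius_to_zero: obtains s where "is_mobius s" "s (Some 0) = x"
proof (cases x)
  case None
  show ?thesis using that[OF is_mobius_mob[of 0 0 1 1]] None by (simp add: mob_def pr_def)
next
  case (Some z)
  show ?thesis using that[OF is_mobius_mob[of 1 1 z 0]] Some by (simp add: mob_def pr_def)
qed

text \<open>A Moebius map moves the point to 0, where small positive reals give infinitely many
  neighbours.\<close>

lemma infinite_nb:
  assumes "eventually P (nb x)" shows "infinite {z. P z}"
proof -
  obtain s where s: "is_mobius s" "s (Some 0) = x" by (rule mobius_to_zero)
  have "eventually (\<lambda>z. P (s z)) (nb (Some 0))"
    using cont_eventually[OF cont_mobius[OF s(1)]] assms s(2) by simp
  then have "eventually (\<lambda>z. P (s (Some z))) (nhds 0)"
    by (simp add: nb_Some eventually_filtermap)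
  then obtain e where e: "e > 0" "\<And>z. dist z 0 < e \<Longrightarrow> P (s (Some z))"
    by (auto simp: eventually_nhds_metric)
  let ?S = "complex_of_real ` {0<..<e}"
  have "infinite ?S" using e(1) infinite_Ioo by (auto simp: finite_image_iff inj_on_def)
  moreover have "inj (\<lambda>z. s (Some z))" using mobius_inv_simps(5)[OF s(1)] by (auto intro!: injI)
  ultimately have "infinite ((\<lambda>z. s (Some z)) ` ?S)"
    by (metis finite_imageD inj_on_subset subset_UNIV)
  then show ?thesis by (rule contrapos_nn) (rule finite_subset, use e(2) in \<open>auto simp: dist_norm\<close>)
qed

text \<open>Two halves of ``F has local degree n at x'': values near \<open>F x\<close> have at most, respectively
  at least, n preimages near x.\<close>

definition locdeg_le :: "(sphere \<Rightarrow> sphere) \<Rightarrow> sphere \<Rightarrow> nat \<Rightarrow> bool" where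
  "locdeg_le F x n \<longleftrightarrow> (\<exists>P. eventually P (nb x) \<and>
     (\<forall>w. finite {z. P z \<and> F z = w} \<and> card {z. P z \<and> F z = w} \<le> n))"

definition locdeg_ge :: "(sphere \<Rightarrow> sphere) \<Rightarrow> sphere \<Rightarrow> nat \<Rightarrow> bool" where
  "locdeg_ge F x n \<longleftrightarrow> (\<forall>P. eventually P (nb x) \<longrightarrow>
     eventually (\<lambda>w. w \<noteq> F x \<longrightarrow> (\<exists>S. finite S \<and> card S = n \<and> S \<subseteq> {z. P z \<and> F z = w})) (nb (F x)))"

text \<open>A fibre of the composite is the union of the fibres of F over a fibre of H.\<close>

lemma locdeg_le_comp:
  assumes F: "cont F" "locdeg_le F x n" and H: "locdeg_le H (F x) m"
  shows "locdeg_le (H \<circ> F) x (m * n)"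
proof -
  obtain P where P: "eventually P (nb x)" "\<And>w. finite {z. P z \<and> F z = w}" "\<And>w. card {z. P z \<and> F z = w} \<le> n"
    using F(2) by (auto simp: locdeg_le_def)
  obtain Q where Q: "eventually Q (nb (F x))" "\<And>w. finite {z. Q z \<and> H z = w}" "\<And>w. card {z. Q z \<and> H z = w} \<le> m"
    using H by (auto simp: locdeg_le_def)
  have ev: "eventually (\<lambda>z. P z \<and> Q (F z)) (nb x)"
    using P(1) cont_eventually[OF F(1) Q(1)] by (rule eventually_conj)
  have "finite {z. (P z \<and> Q (F z)) \<and> (H \<circ> F) z = w} \<and> card {z. (P z \<and> Q (F z)) \<and> (H \<circ> F) z = w} \<le> m * n" for w
  proof -
    let ?A = "{v. Q v \<and> H v = w}"
    have eq: "{z. (P z \<and> Q (F z)) \<and> (H \<circ> F) z = w} = (\<Union>v\<in>?A. {z. P z \<and> F z = v})" by auto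
    have "card (\<Union>v\<in>?A. {z. P z \<and> F z = v}) \<le> (\<Sum>v\<in>?A. card {z. P z \<and> F z = v})"
      by (rule card_UN_le) (rule Q(2))
    also have "\<dots> \<le> card ?A * n" using sum_bounded_above[of ?A "\<lambda>v. card {z. P z \<and> F z = v}" n] P(3) by simp
    also have "\<dots> \<le> m * n" using Q(3) by (rule mult_right_mono) simp
    finally show ?thesis unfolding eq using P(2) Q(2) by auto
  qed
  then show ?thesis using ev unfolding locdeg_le_def by blast
qed

lemma locdeg_ge_comp:
  assumes F: "locdeg_ge F x n" and H: "locdeg_ge H (F x) m"
  shows "locdeg_ge (H \<circ> F) x (m * n)"
  unfolding locdeg_ge_def
proof (intro allI impI)
  fix P assume P: "eventually P (nb x)"
  define Q where "Q w \<longleftrightarrow> (w \<noteq> F x \<longrightarrow> (\<exists>S. finite S \<and> card S = n \<and> S \<subseteq> {z. P z \<and> F z = w}))" for w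
  have Q: "eventually Q (nb (F x))" using F P unfolding locdeg_ge_def Q_def by blast
  have "eventually (\<lambda>w. w \<noteq> H (F x) \<longrightarrow> (\<exists>S. finite S \<and> card S = m \<and> S \<subseteq> {z. Q z \<and> H z = w})) (nb (H (F x)))"
    using H Q unfolding locdeg_ge_def by blast
  then show "eventually (\<lambda>w. w \<noteq> (H \<circ> F) x \<longrightarrow>
    (\<exists>S. finite S \<and> card S = m * n \<and> S \<subseteq> {z. P z \<and> (H \<circ> F) z = w})) (nb ((H \<circ> F) x))"
    unfolding o_apply
  proof (rule eventually_mono, intro impI)
    fix w assume "w \<noteq> H (F x) \<longrightarrow> (\<exists>S. finite S \<and> card S = m \<and> S \<subseteq> {z. Q z \<and> H z = w})" "w \<noteq> H (F x)"
    then obtain S where S: "finite S" "card S = m" "S \<subseteq> {z. Q z \<and> H z = w}" by blast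
    \<comment> \<open>Since w differs from \<open>H (F x)\<close>, every v in S differs from
      \<open>F x\<close>, so \<open>Q v\<close> does provide n preimages.\<close>
    have "\<forall>v\<in>S. \<exists>T. finite T \<and> card T = n \<and> T \<subseteq> {z. P z \<and> F z = v}"
      using S(3) \<open>w \<noteq> H (F x)\<close> by (auto simp: Q_def)
    then obtain T where T: "\<And>v. v \<in> S \<Longrightarrow> finite (T v) \<and> card (T v) = n \<and> T v \<subseteq> {z. P z \<and> F z = v}"
      by metis
    have "card (\<Union>v\<in>S. T v) = (\<Sum>v\<in>S. card (T v))"
      by (rule card_UN_disjoint) (use S T in \<open>auto, blast\<close>)
    also have "\<dots> = m * n" using S T by simp
    finally show "\<exists>S. finite S \<and> card S = m * n \<and> S \<subseteq> {z. P z \<and> H (F z) = w}"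
      using S T by (intro exI[of _ "\<Union>v\<in>S. T v"]) auto
  qed
qed

lemma locdeg_mobius:
  assumes "is_mobius s" shows "locdeg_le s x 1" "locdeg_ge s x 1"
proof -
  have "{z. s z = w} = {sinv s w}" for w
    using mobius_inv_simps[OF assms] by auto
  then show "locdeg_le s x 1" unfolding locdeg_le_def by (intro exI[of _ "\<lambda>_. True"]) auto
  show "locdeg_ge s x 1" unfolding locdeg_ge_def
  proof (intro allI impI)
    fix P assume P: "eventually P (nb x)"
    then have "eventually (\<lambda>w. P (sinv s w)) (nb (s x))"
      using cont_eventually[OF cont_mobius[OF is_mobius_inverse(2)[OF assms]], of P "s x"]
      by (simp add: mobius_inv_simps[OF assms])
    then show "eventually (\<lambda>w. w \<noteq> s x \<longrightarrow> (\<exists>S. finite S \<and> card S = 1 \<and> S \<subseteq> {z. P z \<and> s z = w})) (nb (s x))"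
      by (rule eventually_mono) (auto intro!: exI[of _ "{sinv s _}"] simp: mobius_inv_simps[OF assms])
  qed
qed

section \<open>Local degree of squaring\<close>

lemma locdeg_le_sq: "locdeg_le sq x (if x \<in> crit then 2 else 1)"
proof (cases "x \<in> crit")
  case True
  have "finite {z. sq z = w} \<and> card {z. sq z = w} \<le> 2" for w
  proof -
    obtain u where "sq u = w" using surj_sq by blast
    then have "{z. sq z = w} = {u, neg u}" using sq_eq_iff[of _ u] by auto
    then show ?thesis by (simp add: card_insert_if)
  qed
  then show ?thesis using True unfolding locdeg_le_def by (intro exI[of _ "\<lambda>_. True"]) auto
next
  case False
  then obtain a where a: "x = Some a" "a \<noteq> 0" by (cases x) auto
  \<comment> \<open>The open disc about a of radius |a| contains no two opposite points, so squaring
    is injective on it.\<close>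
  define P where "P s \<longleftrightarrow> (case s of None \<Rightarrow> False | Some z \<Rightarrow> dist z a < norm a)" for s
  have ev: "eventually P (nb x)" unfolding a(1) nb_Some eventually_filtermap P_def
    using a(2) by (auto simp: eventually_nhds_metric intro!: exI[of _ "norm a"])
  have inj: "z = z'" if "P z" "P z'" "sq z = sq z'" for z z'
  proof -
    have "z \<noteq> neg z'"
    proof
      assume n: "z = neg z'"
      obtain b where b: "z' = Some b" using \<open>P z'\<close> by (auto simp: P_def split: option.splits)
      have "norm (b - a) < norm a" "norm (- b - a) < norm a"
        using \<open>P z\<close> \<open>P z'\<close> n b by (simp_all add: P_def neg_def dist_norm)
      moreover have "norm (2 * a) \<le> norm (b - a) + norm (- b - a)"
        using norm_triangle_ineq4[of "- b - a" "a - b"] norm_triangle_ineq[of "b - a" "- b - a"]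
        by (simp add: norm_minus_commute)
      ultimately show False by (simp add: norm_mult)
    qed
    then show ?thesis using \<open>sq z = sq z'\<close> sq_eq_iff by blast
  qed
  have "finite {z. P z \<and> sq z = w} \<and> card {z. P z \<and> sq z = w} \<le> 1" for w
  proof (cases "\<exists>z. P z \<and> sq z = w")
    case True
    then obtain z where "P z" "sq z = w" by blast
    then have "{z. P z \<and> sq z = w} = {z}" using inj by blast
    then show ?thesis by simp
  next
    case False
    then have "{z. P z \<and> sq z = w} = {}" by blast
    then show ?thesis by (simp only: finite.emptyI card.empty) simp
  qed
  then show ?thesis using False ev unfolding locdeg_le_def by auto
qed

lemma locdeg_ge_sq_finite: "locdeg_ge sq (Some a) (if a = 0 then 2 else 1)"
  unfolding locdeg_ge_def
proof (intro allI impI)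
  fix P assume "eventually P (nb (Some a))"
  then obtain e where e: "e > 0" "\<And>z. dist z a < e \<Longrightarrow> P (Some z)"
    by (auto simp: nb_Some eventually_filtermap eventually_nhds_metric)
  have "\<exists>S. finite S \<and> card S = (if a = 0 then 2 else 1) \<and> S \<subseteq> {z. P z \<and> sq z = Some b}"
    if b: "dist b (a^2) < e^2" "b \<noteq> a^2" for b
  proof -
    define v where "v = csqrt b"
    have v: "v^2 = b" by (simp add: v_def)
    \<comment> \<open>The product of the distances from a to the two square roots of b is |b - a^2|,
      so one of the roots lies within e of a; for a = 0 both do.\<close>
    have lt: "norm (v - a) * norm (- v - a) < e^2"
    proof -
      have "(v - a) * (- v - a) = - (b - a^2)" by (simp add: v[symmetric] algebra_simps power2_eq_square)
      then show ?thesis using b(1) by (metis dist_norm norm_minus_cancel norm_mult)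
    qed
    then have or: "norm (v - a) < e \<or> norm (- v - a) < e"
      using e(1) by (metis linorder_not_le mult_mono power2_eq_square less_le norm_ge_zero)
    show ?thesis
    proof (cases "a = 0")
      case True
      then have "v \<noteq> 0" using b v by auto
      moreover have "norm v < e" "norm (- v) < e" using or True by auto
      ultimately show ?thesis using e(2)[of v] e(2)[of "-v"] v True
        by (intro exI[of _ "{Some v, Some (- v)}"]) (auto simp: dist_norm sq_def card_insert_if)
    next
      case False
      from or show ?thesis
      proof
        assume "norm (v - a) < e"
        then show ?thesis using e(2)[of v] v False
          by (intro exI[of _ "{Some v}"]) (auto simp: dist_norm sq_def)
      next
        assume "norm (- v - a) < e"
        then show ?thesis using e(2)[of "- v"] v False
          by (intro exI[of _ "{Some (- v)}"]) (auto simp: dist_norm sq_def)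
      qed
    qed
  qed
  then show "eventually (\<lambda>w. w \<noteq> sq (Some a) \<longrightarrow> (\<exists>S. finite S \<and> card S = (if a = 0 then 2 else 1) \<and>
      S \<subseteq> {z. P z \<and> sq z = w})) (nb (sq (Some a)))"
    unfolding sq_def option.map nb_Some eventually_filtermap eventually_nhds_metric
    using e(1) by (intro exI[of _ "e^2"]) auto
qed

lemma locdeg_ge_sq: "locdeg_ge sq x (if x \<in> crit then 2 else 1)"
proof (cases x)
  case (Some a) then show ?thesis using locdeg_ge_sq_finite[of a] by auto
next
  case None
  let ?i = "mob 0 1 1 0"
  have i: "is_mobius ?i" by (rule is_mobius_mob) simp
  \<comment> \<open>The inversion z to 1/z commutes with squaring and carries infinity to 0.\<close>
  have eq: "?i \<circ> sq \<circ> ?i = sq"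
  proof
    fix s obtain x y where s: "x \<noteq> 0 \<or> y \<noteq> 0" "s = pr x y" by (rule ex_pr)
    have "?i (sq (?i (pr x y))) = sq (pr x y)"
      using s(1) by (subst mob_pr; auto simp: sq_pr)+
    then show "(?i \<circ> sq \<circ> ?i) s = sq s" by (simp add: s)
  qed
  have "?i None = Some 0" by (simp add: mob_def pr_def)
  then have "locdeg_ge sq (?i None) 2" using locdeg_ge_sq_finite[of 0] by simp
  then have "locdeg_ge (?i \<circ> (sq \<circ> ?i)) None (1 * (2 * 1))"
    by (intro locdeg_ge_comp locdeg_mobius i)
  then show ?thesis using None eq by (simp add: comp_assoc)
qed

section \<open>Visits of an orbit to the critical set\<close>

definition visits :: "('a \<Rightarrow> 'a) \<Rightarrow> 'a set \<Rightarrow> nat \<Rightarrow> 'a \<Rightarrow> nat" where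
  "visits g C n x = card {j. j < n \<and> (g ^^ j) x \<in> C}"

lemma visits_Suc_right: "visits g C (Suc n) x = visits g C n x + (if (g ^^ n) x \<in> C then 1 else 0)"
proof -
  have "{j. j < Suc n \<and> (g ^^ j) x \<in> C} =
    (if (g ^^ n) x \<in> C then insert n {j. j < n \<and> (g ^^ j) x \<in> C} else {j. j < n \<and> (g ^^ j) x \<in> C})"
    by (auto simp: less_Suc_eq)
  then show ?thesis by (simp add: visits_def)
qed

lemma visits_0 [simp]: "visits g C 0 x = 0"
  by (simp add: visits_def)

lemma visits_add: "visits g C (m + n) x = visits g C m x + visits g C n ((g ^^ m) x)"
proof (induction n)
  case (Suc n)
  have "(g ^^ (m + n)) x = (g ^^ n) ((g ^^ m) x)" by (metis add.commute comp_apply funpow_add)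
  then show ?case using Suc by (simp add: visits_Suc_right)
qed simp

lemma visits_Suc: "visits g C (Suc n) x = (if x \<in> C then 1 else 0) + visits g C n (g x)"
  using visits_add[of g C 1 n x] by (simp add: visits_Suc_right)

lemma visits_eq_0_iff: "visits g C n x = 0 \<longleftrightarrow> (\<forall>j<n. (g ^^ j) x \<notin> C)"
  by (auto simp: visits_def)

lemma first_visit:
  assumes "visits g C k x > 0"
  obtains s where "s < k" "(g ^^ s) x \<in> C" "visits g C k x = visits g C (k - s) ((g ^^ s) x)"
    "s = 0 \<longleftrightarrow> x \<in> C"
proof -
  have ex: "\<exists>j. j < k \<and> (g ^^ j) x \<in> C" using assms visits_eq_0_iff[of g C k x] by auto
  define s where "s = (LEAST j. j < k \<and> (g ^^ j) x \<in> C)"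
  have s: "s < k" "(g ^^ s) x \<in> C" unfolding s_def using LeastI_ex[OF ex] by auto
  have min: "(g ^^ j) x \<notin> C" if "j < s" for j
    using not_less_Least[of j "\<lambda>j. j < k \<and> (g ^^ j) x \<in> C"] that s(1) unfolding s_def by auto
  then have "visits g C s x = 0" by (simp add: visits_eq_0_iff)
  then have "visits g C k x = visits g C (k - s) ((g ^^ s) x)"
    using visits_add[of g C s "k - s" x] s(1) by simp
  moreover have "s = 0 \<longleftrightarrow> x \<in> C" using s(2) min[of 0] by (metis funpow_0 gr0I)
  ultimately show ?thesis using that s by blast
qed

text \<open>A point outside \<open>{a, b}\<close> reaches it at a time \<open>s > 0\<close>, at e say. Comparing the two counts,
  the orbit of e makes no visit during \<open>[k - s, k)\<close>, and this segment is a full period. Hence the last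
  point of \<open>{a, b}\<close> on the orbit of e never returns to \<open>{a, b}\<close>.\<close>

lemma no_synchronous_point:
  assumes k: "(g ^^ k) a = w" "(g ^^ k) b = w" "(g ^^ k) x = w"
    and v: "visits g {a, b} k a = n" "visits g {a, b} k b = n" "visits g {a, b} k x = n"
    and n: "n \<ge> 2"
  shows "x \<in> {a, b}"
proof (rule ccontr)
  assume x: "x \<notin> {a, b}"
  let ?C = "{a, b}" and ?V = "visits g {a, b}"
  obtain s where s: "s < k" "(g ^^ s) x \<in> ?C" "?V k x = ?V (k - s) ((g ^^ s) x)" "s \<noteq> 0"
    using first_visit[of g ?C k x] v n x by (metis gr0I not_numeral_le_zero)
  define e where "e = (g ^^ s) x"
  define y where "y = (g ^^ (k - s)) e"
  have y: "y = w" using s(1) k(3) unfolding y_def e_def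
    by (metis add_diff_inverse_nat comp_apply funpow_add less_imp_not_less add.commute)
  have Ve: "?V k e = n" "(g ^^ k) e = w" using s(2) v(1,2) k(1,2) unfolding e_def by auto
  have "?V k e = ?V (k - s) e + ?V s y"
    using visits_add[of g ?C "k - s" s e] s(1) unfolding y_def by simp
  then have "?V s y = 0" using Ve(1) s(3) v(3) unfolding e_def by simp
  then have ny: "(g ^^ j) y \<notin> ?C" if "j < s" for j
    using that iffD1[OF visits_eq_0_iff[of g ?C s y]] by blast
  have per: "(g ^^ s) y = y"
  proof -
    have "(g ^^ s) y = (g ^^ k) e" using s(1) unfolding y_def
      by (metis comp_apply funpow_add le_add_diff_inverse less_imp_le)
    then show ?thesis using Ve(2) y by simp
  qed
  have never: "(g ^^ j) y \<notin> ?C" for j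
    using funpow_mod_eq[OF per, of j] ny[of "j mod s"] s(4) by simp
  define T where "T = {j. j < k \<and> (g ^^ j) e \<in> ?C}"
  have fT: "finite T" and cT: "card T = n" using Ve(1) by (auto simp: T_def visits_def)
  have neT: "T \<noteq> {}" using cT n by auto
  define t where "t = Max T"
  have t: "t \<in> T" "\<And>j. j \<in> T \<Longrightarrow> j \<le> t" using fT neT by (auto simp: t_def)
  define e1 where "e1 = (g ^^ t) e"
  have e1: "e1 \<in> ?C" using t(1) by (simp add: T_def e1_def)
  \<comment> \<open>A later visit before time k of the orbit of e contradicts the maximality of t;
    from time k - s on this orbit is that of y, which makes no visits.\<close>
  have "{j. j < k \<and> (g ^^ j) e1 \<in> ?C} \<subseteq> {0}"
  proof
    fix j assume "j \<in> {j. j < k \<and> (g ^^ j) e1 \<in> ?C}"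
    then have j: "(g ^^ (j + t)) e \<in> ?C" by (simp add: e1_def funpow_add)
    show "j \<in> {0}"
    proof (cases "j + t < k")
      case True
      then show ?thesis using t(2)[of "j + t"] j by (simp add: T_def)
    next
      case False
      then have "(g ^^ (j + t)) e = (g ^^ (j + t - (k - s))) y" unfolding y_def
        using funpow_add[of "j + t - (k - s)" "k - s" g] by simp
      then show ?thesis using never j by simp
    qed
  qed
  then have "?V k e1 \<le> 1" unfolding visits_def using card_mono[of "{0::nat}"] by fastforce
  then show False using e1 v n by auto
qed

section \<open>Deck transformations and local degree\<close>

text \<open>The m preimages near x of a value near \<open>F x\<close> are carried injectively by t
  to preimages of the same value near \<open>t x\<close>.\<close>

lemma deck_locdeg_le:
  assumes "is_mobius t" "F \<circ> t = F" "locdeg_ge F x m" "locdeg_le F (t x) n"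
  shows "m \<le> n"
proof -
  obtain P where P: "eventually P (nb (t x))" "\<And>w. finite {z. P z \<and> F z = w}" "\<And>w. card {z. P z \<and> F z = w} \<le> n"
    using assms(4) by (auto simp: locdeg_le_def)
  have "eventually (\<lambda>z. P (t z)) (nb x)" by (rule cont_eventually[OF cont_mobius[OF assms(1)] P(1)])
  then have "eventually (\<lambda>w. w \<noteq> F x \<longrightarrow> (\<exists>S. finite S \<and> card S = m \<and> S \<subseteq> {z. P (t z) \<and> F z = w})) (nb (F x))"
    using assms(3) unfolding locdeg_ge_def by blast
  then have inf: "infinite {w. w \<noteq> F x \<longrightarrow> (\<exists>S. finite S \<and> card S = m \<and> S \<subseteq> {z. P (t z) \<and> F z = w})}"
    (is "infinite ?W") by (rule infinite_nb)
  have "\<not> ?W \<subseteq> {F x}" using inf by (meson finite.intros finite_subset)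
  then obtain w where "w \<noteq> F x" "w \<in> ?W" by blast
  then obtain S where S: "finite S" "card S = m" "S \<subseteq> {z. P (t z) \<and> F z = w}" by blast
  have "t ` S \<subseteq> {z. P z \<and> F z = w}" using S(3) assms(2) by (auto simp: fun_eq_iff)
  then have "card (t ` S) \<le> n" by (rule order_trans[OF card_mono[OF P(2)] P(3)])
  moreover have "card (t ` S) = m" using S(2) mobius_inv_simps(5)[OF assms(1)]
    by (simp add: card_image inj_on_def)
  ultimately show ?thesis by simp
qed

text \<open>For suitable z close to the fixed point, z, \<open>t z\<close> and
  \<open>t (t z)\<close> are three distinct points of one fibre close to y. Only the finitely many
  fixed points of t and of its square must be avoided.\<close>

lemma deck_fixed_locdeg:
  assumes t: "is_mobius t" "F \<circ> t = F" "t y = y" "t \<noteq> id" "t \<circ> t \<noteq> id" and "locdeg_le F y n"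
  shows "3 \<le> n"
proof -
  obtain P where P: "eventually P (nb y)" "\<And>w. finite {z. P z \<and> F z = w}" "\<And>w. card {z. P z \<and> F z = w} \<le> n"
    using assms(6) by (auto simp: locdeg_le_def)
  have ev: "eventually (\<lambda>z. Q (t z)) (nb y)" if "eventually Q (nb y)" for Q
    using cont_eventually[OF cont_mobius[OF t(1)], of Q y] that t(3) by simp
  have "eventually (\<lambda>z. P z \<and> P (t z) \<and> P (t (t z))) (nb y)"
    using P(1) ev[OF P(1)] ev[OF ev[OF P(1)]] by (simp add: eventually_conj_iff)
  then have inf: "infinite {z. P z \<and> P (t z) \<and> P (t (t z))}" by (rule infinite_nb)
  have fin: "finite ({z. t z = z} \<union> {z. (t \<circ> t) z = z})"
    using mobius_fixed_points(1)[OF t(1,4)] mobius_fixed_points(1)[OF is_mobius_comp[OF t(1,1)] t(5)] by simp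
  have "\<exists>z. (P z \<and> P (t z) \<and> P (t (t z))) \<and> t z \<noteq> z \<and> t (t z) \<noteq> z"
  proof -
    have "\<not> {z. P z \<and> P (t z) \<and> P (t (t z))} \<subseteq> {z. t z = z} \<union> {z. (t \<circ> t) z = z}"
      using inf finite_subset[OF _ fin] by blast
    then show ?thesis by auto
  qed
  then obtain z where z: "P z" "P (t z)" "P (t (t z))" "t z \<noteq> z" "t (t z) \<noteq> z" by blast
  have Ft: "F (t v) = F v" for v using t(2) by (metis comp_apply)
  have "{z, t z, t (t z)} \<subseteq> {v. P v \<and> F v = F z}" using z Ft[of z] Ft[of "t z"] by simp
  then have "card {z, t z, t (t z)} \<le> n" by (rule order_trans[OF card_mono[OF P(2)] P(3)])
  moreover have "card {z, t z, t (t z)} = 3" using z(4,5) mobius_inv_simps(5)[OF t(1)] by (simp add: card_insert_if eq_commute[of z])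
  ultimately show ?thesis by simp
qed

lemma DeckD: "t \<in> Deck F \<Longrightarrow> is_mobius t" "t \<in> Deck F \<Longrightarrow> F \<circ> t = F" "t \<in> Deck F \<Longrightarrow> F (t x) = F x"
  by (auto simp: Deck_def fun_eq_iff)

lemma DeckI: "is_mobius t \<Longrightarrow> (\<And>x. F (t x) = F x) \<Longrightarrow> t \<in> Deck F"
  by (auto simp: Deck_def fun_eq_iff)

lemma Deck_id: "id \<in> Deck F"
  by (rule DeckI) (auto simp: is_mobius_id)

lemma Deck_comp: "s \<in> Deck F \<Longrightarrow> t \<in> Deck F \<Longrightarrow> s \<circ> t \<in> Deck F"
  by (rule DeckI) (auto simp: DeckD is_mobius_comp)

lemma Deck_funpow: "s \<in> Deck F \<Longrightarrow> s ^^ n \<in> Deck F"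
  by (induction n) (auto simp: Deck_id Deck_comp)

lemma Deck_inv: "s \<in> Deck F \<Longrightarrow> sinv s \<in> Deck F"
  by (rule DeckI) (metis DeckD is_mobius_inverse(2), metis DeckD(1,3) mobius_inv_simps(1))

lemma Deck_mono: "Deck F \<subseteq> Deck (H \<circ> F)"
  by (auto simp: Deck_def o_assoc[symmetric])

lemma Deck_funpow_mono: "Deck (g ^^ k) \<subseteq> Deck (g ^^ (j + k))"
  unfolding funpow_add by (rule Deck_mono)

text \<open>Local degrees cannot decrease under a deck transformation; this is applied to t and to
  its inverse.\<close>

lemma deck_visits_step:
  assumes "t \<in> Deck F" "\<And>x. locdeg_le F x (2 ^ v x)" "\<And>x. locdeg_ge F x (2 ^ v x)"
  shows "v (t x) = v x"
proof (rule antisym)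
  have "(2::nat) ^ v x \<le> 2 ^ v (t x)"
    using deck_locdeg_le[OF DeckD(1,2)[OF assms(1)] assms(3) assms(2)] .
  then show "v x \<le> v (t x)" by simp
  have "(2::nat) ^ v (t x) \<le> 2 ^ v (sinv t (t x))"
    using deck_locdeg_le[OF DeckD(1,2)[OF Deck_inv[OF assms(1)]] assms(3) assms(2)] .
  then show "v (t x) \<le> v x" by (simp add: mobius_inv_simps[OF DeckD(1)[OF assms(1)]])
qed

section \<open>Rotations and flips\<close>

definition rot :: "complex \<Rightarrow> sphere \<Rightarrow> sphere" where "rot c = mob c 0 0 1"
definition flip :: "complex \<Rightarrow> sphere \<Rightarrow> sphere" where "flip c = mob 0 c 1 0"

lemma is_mobius_rot: "c \<noteq> 0 \<Longrightarrow> is_mobius (rot c)" and is_mobius_flip: "c \<noteq> 0 \<Longrightarrow> is_mobius (flip c)"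
  unfolding rot_def flip_def by (auto intro: is_mobius_mob)

lemma rot_comp:
  assumes "a \<noteq> 0" "b \<noteq> 0"
  shows "rot a \<circ> rot b = rot (a * b)" "rot a \<circ> flip b = flip (a * b)"
    "flip a \<circ> rot b = flip (a / b)" "flip a \<circ> flip b = rot (a / b)"
proof -
  show "rot a \<circ> rot b = rot (a * b)" "rot a \<circ> flip b = flip (a * b)"
    unfolding rot_def flip_def using assms by (simp_all add: mob_comp)
  show "flip a \<circ> rot b = flip (a / b)" "flip a \<circ> flip b = rot (a / b)"
    unfolding rot_def flip_def using assms
    by (auto simp: mob_comp fun_eq_iff mob_def pr_def field_simps split: option.splits)
qed

lemma rot_simps [simp]: "rot c (Some z) = Some (c * z)" "rot c (Some 1) = Some c"
    "c \<noteq> 0 \<Longrightarrow> rot c None = None"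
    "flip c (Some 0) = None" "flip c None = Some 0" "z \<noteq> 0 \<Longrightarrow> flip c (Some z) = Some (c / z)"
  by (auto simp: rot_def flip_def mob_def pr_def)

lemma rot_inj: "rot a = rot b \<longleftrightarrow> a = b"
  by (metis rot_simps(2) option.inject)

lemma flip_inj: "flip a = flip b \<longleftrightarrow> a = b"
  by (metis rot_simps(6) option.inject div_by_1 zero_neq_one)

lemma rot_neq_flip: "a \<noteq> 0 \<Longrightarrow> rot a \<noteq> flip b"
  by (metis rot_simps(3,5) option.distinct(1))

lemma rot_1: "rot 1 = id"
  unfolding rot_def by (rule mob_scalar) simp

lemma neg_eq_rot: "neg = rot (-1)"
  by (simp add: neg_eq_mob rot_def)

lemma mobius_crit:
  assumes "is_mobius t" "t ` crit \<subseteq> crit"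
  shows "(\<exists>c. c \<noteq> 0 \<and> t = rot c) \<or> (\<exists>c. c \<noteq> 0 \<and> t = flip c)"
proof -
  obtain a b c d where *: "a * d - b * c \<noteq> 0" "t = mob a b c d" using assms(1) by (rule is_mobiusE)
  have t: "t (Some 0) = pr b d" "t None = pr a c" by (simp_all add: * mob_def)
  show ?thesis
  proof (cases "d = 0")
    case True
    then have "b \<noteq> 0" "c \<noteq> 0" using * by auto
    moreover have "a = 0" using assms(2) t(2) calculation by (auto simp: pr_def split: if_splits)
    ultimately have "t = flip (b / c)" using True
      by (auto simp: * flip_def fun_eq_iff mob_def pr_def field_simps split: option.splits)
    then show ?thesis using \<open>b \<noteq> 0\<close> \<open>c \<noteq> 0\<close> divide_eq_0_iff by blast
  next
    case False
    then have b: "b = 0" using assms(2) t(1) by (auto simp: pr_def split: if_splits)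
    then have "a \<noteq> 0" using * by auto
    moreover have "c = 0" using assms(2) t(2) calculation by (auto simp: pr_def split: if_splits)
    ultimately have "t = rot (a / d)" using False b
      by (auto simp: * rot_def fun_eq_iff mob_def pr_def field_simps split: option.splits)
    then show ?thesis using \<open>a \<noteq> 0\<close> False divide_eq_0_iff by blast
  qed
qed

text \<open>The critical set is the fixed point set of \<open>neg\<close>, and commuting maps
  preserve each other's fixed point sets.\<close>

lemma crit_if_commute: "(\<And>x. t (neg x) = neg (t x)) \<Longrightarrow> t ` crit \<subseteq> crit"
  by (metis image_subsetI neg_eq_self_iff)

lemma sq_rot: "sq (rot c x) = rot (c^2) (sq x)" if "c \<noteq> 0"
  using that by (cases x) (auto simp: sq_def power_mult_distrib)

section \<open>Permutations of finite sets\<close>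

lemma infinite_sphere: "infinite (UNIV :: sphere set)"
  using infinite_UNIV_char_0[where 'a = complex] by (simp add: finite_option_UNIV)

text \<open>By the pigeonhole principle two iterates agree on all of F; injectivity cancels the
  smaller exponent.\<close>

lemma common_period:
  fixes t :: "'a \<Rightarrow> 'a"
  assumes "finite F" "t ` F \<subseteq> F" "inj t"
  obtains n where "n > 0" "\<And>x. x \<in> F \<Longrightarrow> (t ^^ n) x = x"
proof -
  obtain xs where xs: "set xs = F" using finite_list[OF assms(1)] by blast
  have st: "(t ^^ i) x \<in> F" if "x \<in> F" for i x using that assms(2) by (induction i) auto
  have "range (\<lambda>i. map (t ^^ i) xs) \<subseteq> {l. set l \<subseteq> F \<and> length l = length xs}"
    using st xs by auto
  then have "finite (range (\<lambda>i. map (t ^^ i) xs))"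
    using finite_lists_length_eq[OF assms(1)] finite_subset by blast
  then obtain i j :: nat where "i < j" "map (t ^^ i) xs = map (t ^^ j) xs"
    using infinite_UNIV_nat finite_imageD[of "\<lambda>i. map (t ^^ i) xs" UNIV] unfolding inj_on_def
    by (metis linorder_neqE_nat)
  then have eq: "(t ^^ i) x = (t ^^ i) ((t ^^ (j - i)) x)" if "x \<in> F" for x
    using that xs by (metis add_diff_inverse_nat comp_apply funpow_add map_eq_conv order_less_imp_not_less)
  have "inj (t ^^ i)" using inj_fn[OF assms(3)] .
  then show ?thesis using that[of "j - i"] eq \<open>i < j\<close> by (metis inj_eq zero_less_diff)
qed

text \<open>F is partitioned into orbits, each of exactly d points.\<close>

lemma free_orbits_dvd_card:
  fixes t :: "'a \<Rightarrow> 'a"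
  assumes "finite F" "t ` F \<subseteq> F" "t ^^ d = id" "d > 0" "inj t"
    and free: "\<And>i x. 0 < i \<Longrightarrow> i < d \<Longrightarrow> x \<in> F \<Longrightarrow> (t ^^ i) x \<noteq> x"
  shows "d dvd card F"
proof -
  define orb where "orb x = (\<lambda>i. (t ^^ i) x) ` {..<d}" for x
  have tm: "(t ^^ i) x \<in> orb x" for i x
  proof -
    have "(t ^^ i) x = (t ^^ (i mod d)) x"
      using funpow_mod_eq[where f = t and n = d and m = i and x = x] assms(3) by simp
    then show ?thesis using assms(4) by (auto simp: orb_def)
  qed
  have st: "(t ^^ i) x \<in> F" if "x \<in> F" for i x using that assms(2) by (induction i) auto
  have self: "x \<in> orb x" for x using tm[of 0 x] by simp
  have sub: "orb y \<subseteq> orb x" if "y \<in> orb x" for x y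
  proof -
    obtain i where "y = (t ^^ i) x" using \<open>y \<in> orb x\<close> unfolding orb_def by blast
    then have "(t ^^ j) y = (t ^^ (j + i)) x" for j by (simp add: funpow_add)
    then show ?thesis using tm by (auto simp: orb_def[of y])
  qed
  have sym: "x \<in> orb y" if y: "y \<in> orb x" for x y
  proof -
    obtain i where i: "y = (t ^^ i) x" "i < d" using y by (auto simp: orb_def)
    have "(t ^^ (d - i)) y = x" using i assms(3)
      by (metis add.commute add_diff_inverse_nat comp_apply funpow_add id_apply order_less_imp_not_less)
    then show ?thesis using tm by metis
  qed
  have Un: "\<Union> (orb ` F) = F" using st self by (auto simp: orb_def)
  have "d dvd card (\<Union> (orb ` F))"
  proof (rule dvd_partition)
    show "finite (\<Union> (orb ` F))" using Un assms(1) by simp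
    show "\<forall>c\<in>orb ` F. d dvd card c"
    proof
      fix c assume "c \<in> orb ` F"
      then obtain x where x: "x \<in> F" "c = orb x" by blast
      have "(t ^^ i) x \<noteq> (t ^^ j) x" if "i < j" "j < d" for i j
      proof
        assume "(t ^^ i) x = (t ^^ j) x"
        then have "(t ^^ i) x = (t ^^ i) ((t ^^ (j - i)) x)"
          using that(1) by (metis add_diff_inverse_nat comp_apply funpow_add order_less_imp_not_less)
        then have "x = (t ^^ (j - i)) x" using inj_fn[OF assms(5), of i] by (simp add: inj_eq)
        then show False using free[of "j - i" x] that x less_imp_diff_less[of j d i] by simp
      qed
      then have "inj_on (\<lambda>i. (t ^^ i) x) {..<d}"
        by (intro inj_onI) (metis lessThan_iff linorder_neqE_nat)
      then show "d dvd card c" by (simp add: x orb_def card_image)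
    qed
    show "\<forall>c1\<in>orb ` F. \<forall>c2\<in>orb ` F. c1 \<noteq> c2 \<longrightarrow> c1 \<inter> c2 = {}"
      using sub sym by blast
  qed
  then show ?thesis by (simp add: Un)
qed

section \<open>Iterates of a Moebius transformation after squaring\<close>

text \<open>Conjugating \<open>A \<circ> sq \<circ> B\<close> by B gives
  \<open>B \<circ> A \<circ> sq\<close>, so up to conjugation a single Moebius map M determines a
  quadratic map.\<close>

locale mobius_square =
  fixes M :: "sphere \<Rightarrow> sphere"
  assumes M: "is_mobius M"
begin

definition g :: "sphere \<Rightarrow> sphere" where "g = M \<circ> sq"

abbreviation V :: "nat \<Rightarrow> sphere \<Rightarrow> nat" where "V \<equiv> visits g crit"

lemma cont_g: "cont g"
  unfolding g_def by (intro cont_comp cont_sq cont_mobius M)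

lemma locdeg_g: "locdeg_le g x (if x \<in> crit then 2 else 1)" "locdeg_ge g x (if x \<in> crit then 2 else 1)"
  using locdeg_le_comp[OF cont_sq locdeg_le_sq locdeg_mobius(1)[OF M]]
    locdeg_ge_comp[OF locdeg_ge_sq locdeg_mobius(2)[OF M]]
  unfolding g_def by simp_all

text \<open>Local degrees multiply along the orbit, and each visit to the critical set contributes a
  factor 2.\<close>

lemma locdeg_iterate: "locdeg_le (g ^^ n) x (2 ^ V n x)" "locdeg_ge (g ^^ n) x (2 ^ V n x)"
proof (induction n arbitrary: x)
  case 0
  { case 1 show ?case using locdeg_mobius(1)[OF is_mobius_id] by (simp add: id_def) }
  { case 2 show ?case using locdeg_mobius(2)[OF is_mobius_id] by (simp add: id_def) }
next
  case (Suc n)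
  have e: "2 ^ V (Suc n) x = 2 ^ V n (g x) * (if x \<in> crit then 2 else 1 :: nat)" for x
    by (auto simp: visits_Suc)
  { case 1 show ?case unfolding e funpow_Suc_right
      by (rule locdeg_le_comp[OF cont_g locdeg_g(1) Suc.IH(1)]) }
  { case 2 show ?case unfolding e funpow_Suc_right
      by (rule locdeg_ge_comp[OF locdeg_g(2) Suc.IH(2)]) }
qed

lemma deck_visits: "t \<in> Deck (g ^^ n) \<Longrightarrow> V n (t x) = V n x"
  by (rule deck_visits_step[of t "g ^^ n" "V n"]) (auto intro: locdeg_iterate)

lemma deck_fixed_visits:
  assumes "t \<in> Deck (g ^^ n)" "t y = y" "t \<noteq> id" "t \<circ> t \<noteq> id"
  shows "V n y \<ge> 2"
proof (rule ccontr)
  assume "\<not> ?thesis"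
  then have "V n y = 0 \<or> V n y = 1" by linarith
  moreover have "3 \<le> (2::nat) ^ V n y"
    by (rule deck_fixed_locdeg[OF DeckD(1,2)[OF assms(1)] assms(2-4) locdeg_iterate(1)])
  ultimately show False by auto
qed

lemma neg_in_Deck: "neg \<in> Deck (g ^^ Suc k)"
  unfolding funpow_Suc_right by (rule DeckI) (simp_all add: is_mobius_neg g_def sq_neg)

section \<open>Generic fibres and the order of a deck transformation\<close>

lemma g_eq_iff: "g x = g y \<longleftrightarrow> x = y \<or> x = neg y"
  by (simp add: g_def mobius_inv_simps(5)[OF M] sq_eq_iff)

lemma g_surj: "\<exists>x. g x = y"
  using surj_sq[of "sinv M y"] mobius_inv_simps(1)[OF M, of y] unfolding g_def by (metis comp_apply)

lemma card_vimage_g: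
  assumes "finite S" "S \<inter> g ` crit = {}"
  shows "finite (g -` S) \<and> card (g -` S) = 2 * card S"
  using assms
proof (induction S rule: finite_induct)
  case (insert w S)
  obtain u where u: "g u = w" using g_surj by blast
  have pre: "g -` {w} = {u, neg u}" using u g_eq_iff[of _ u] by auto
  have "u \<notin> crit" using insert.prems u by (metis disjoint_iff image_eqI insertI1)
  then have "u \<noteq> neg u" using neg_eq_self_iff by metis
  then have c: "card (g -` {w}) = 2" by (simp add: pre)
  have "g -` insert w S = g -` {w} \<union> g -` S" "g -` {w} \<inter> g -` S = {}" using insert.hyps by auto
  moreover have "finite (g -` {w})" by (simp add: pre)
  ultimately show ?case using insert c by (simp add: card_Un_disjoint)
qed simp

lemma card_vimage_iterate:
  assumes "finite S" "\<And>j. j < k \<Longrightarrow> S \<inter> (g ^^ Suc j) ` crit = {}"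
  shows "finite ((g ^^ k) -` S) \<and> card ((g ^^ k) -` S) = 2 ^ k * card S"
  using assms
proof (induction k)
  case (Suc k)
  have IH: "finite ((g ^^ k) -` S) \<and> card ((g ^^ k) -` S) = 2 ^ k * card S"
    using Suc.IH[OF Suc.prems(1)] Suc.prems(2) less_SucI by blast
  have "(g ^^ k) -` S \<inter> g ` crit = {}"
    using Suc.prems(2)[of k] by (auto simp: funpow_swap1)
  then have "finite (g -` ((g ^^ k) -` S)) \<and> card (g -` ((g ^^ k) -` S)) = 2 * card ((g ^^ k) -` S)"
    by (intro card_vimage_g) (use IH in auto)
  moreover have "(g ^^ Suc k) -` S = g -` ((g ^^ k) -` S)" by (simp add: funpow_Suc_right vimage_comp del: funpow.simps)
  ultimately show ?case using IH by (simp del: funpow.simps)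
qed (use assms in simp)

text \<open>Only finitely many values are excluded: the images of B and the critical values of the
  iterate.\<close>

lemma generic_fibre:
  assumes "finite B"
  obtains w where "finite ((g ^^ k) -` {w})" "card ((g ^^ k) -` {w}) = 2 ^ k" "(g ^^ k) -` {w} \<inter> B = {}"
proof -
  have "finite ((g ^^ k) ` B \<union> (\<Union>j<k. (g ^^ Suc j) ` crit))" using assms by auto
  then obtain w where w: "w \<notin> (g ^^ k) ` B \<union> (\<Union>j<k. (g ^^ Suc j) ` crit)"
    using ex_new_if_finite[OF infinite_sphere] by blast
  have "finite ((g ^^ k) -` {w}) \<and> card ((g ^^ k) -` {w}) = 2 ^ k * card {w}"
    by (rule card_vimage_iterate) (use w in auto)
  moreover have "(g ^^ k) -` {w} \<inter> B = {}" using w by auto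
  ultimately show ?thesis using that[of w] by simp
qed

text \<open>A deck transformation permutes every fibre. Its order is finite, since a power fixing a
  large fibre pointwise is the identity, and divides 2^K, since the action on a generic fibre of 2^K
  points is free.\<close>

lemma deck_order:
  assumes "t \<in> Deck (g ^^ k)"
  shows "t ^^ (2 ^ (2 + k)) = id"
proof -
  \<comment> \<open>Two additional iterations enlarge the fibre to at least 4 points, more than
    \<open>mobius_fixed_points\<close> allows a nontrivial map to fix.\<close>
  define K where "K = 2 + k"
  have t: "t \<in> Deck (g ^^ K)" using assms Deck_funpow_mono unfolding K_def by blast
  have inj: "inj t" using is_mobius_inverse(1)[OF DeckD(1)[OF t]] bij_is_inj by blast
  have st: "t ` ((g ^^ K) -` {w}) \<subseteq> (g ^^ K) -` {w}" for w using DeckD(3)[OF t] by auto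
  obtain w where w: "finite ((g ^^ K) -` {w})" "card ((g ^^ K) -` {w}) = 2 ^ K"
    by (rule generic_fibre[OF finite.emptyI, of K])
  obtain n where n: "n > 0" "\<And>x. x \<in> (g ^^ K) -` {w} \<Longrightarrow> (t ^^ n) x = x"
    by (rule common_period[OF w(1) st inj]) (rule that)
  have ex: "n > 0 \<and> t ^^ n = id"
  proof (rule ccontr)
    assume "\<not> ?thesis"
    then have ne: "t ^^ n \<noteq> id" using n by blast
    note fp = mobius_fixed_points[OF is_mobius_funpow[OF DeckD(1)[OF t]] ne]
    have "card ((g ^^ K) -` {w}) \<le> card {x. (t ^^ n) x = x}"
      by (rule card_mono[OF fp(1)]) (use n(2) in blast)
    moreover have "(4::nat) \<le> 2 ^ K" by (simp add: K_def)
    ultimately show False using fp(2) w(2) by simp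
  qed
  define d where "d = (LEAST n. n > 0 \<and> t ^^ n = id)"
  have d: "d > 0" "t ^^ d = id" using LeastI[of "\<lambda>n. n > 0 \<and> t ^^ n = id", OF ex] by (auto simp: d_def)
  have min: "t ^^ i \<noteq> id" if "0 < i" "i < d" for i
    using not_less_Least[of i "\<lambda>n. n > 0 \<and> t ^^ n = id"] that by (auto simp: d_def)
  \<comment> \<open>Off the fixed points of the nontrivial powers of t every orbit has full length
    d.\<close>
  define B where "B = (\<Union>i\<in>{0<..<d}. {x. (t ^^ i) x = x})"
  have "finite B" unfolding B_def
    using mobius_fixed_points(1)[OF is_mobius_funpow[OF DeckD(1)[OF t]] min] by auto
  then obtain v where v: "finite ((g ^^ K) -` {v})" "card ((g ^^ K) -` {v}) = 2 ^ K" "(g ^^ K) -` {v} \<inter> B = {}"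
    by (rule generic_fibre)
  have "d dvd card ((g ^^ K) -` {v})"
  proof (rule free_orbits_dvd_card[OF v(1) st d(2,1) inj])
    fix i x assume i: "0 < i" "i < d" and x: "x \<in> (g ^^ K) -` {v}"
    show "(t ^^ i) x \<noteq> x"
    proof
      assume "(t ^^ i) x = x"
      then have "x \<in> B" unfolding B_def using i by (intro UN_I[of i]) simp_all
      then show False using x v(3) by (meson disjoint_iff)
    qed
  qed
  then obtain q where "2 ^ K = d * q" unfolding v(2) by blast
  then have "t ^^ (2 ^ K) = (t ^^ d) ^^ q" by (simp add: funpow_mult mult.commute)
  also have "\<dots> = id" unfolding d(2) by (rule id_funpow)
  finally show ?thesis unfolding K_def .
qed

section \<open>Deck transformations preserve the critical set\<close>

text \<open>If t does not commute with the generator \<open>z \<mapsto> -z\<close>, the latter and its conjugate by t generate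
  a dihedral 2-group, whose central involution exchanges 0 and infinity.\<close>

lemma deck_swap:
  assumes t: "t \<in> Deck (g ^^ Suc k)" and nc: "t \<circ> neg \<noteq> neg \<circ> t"
  obtains r where "r \<in> Deck (g ^^ Suc k)" "r (Some 0) = None"
proof -
  note tm = mobius_inv_simps[OF DeckD(1)[OF t]]
  define s where "s = t \<circ> neg \<circ> sinv t"
  define u where "u = neg \<circ> s"
  have sD: "s \<in> Deck (g ^^ Suc k)" unfolding s_def by (intro Deck_comp Deck_inv t neg_in_Deck)
  have uD: "u \<in> Deck (g ^^ Suc k)" unfolding u_def by (intro Deck_comp sD neg_in_Deck)
  have ss: "s (s x) = x" for x by (simp add: s_def tm)
  have "s \<noteq> neg"
  proof
    assume "s = neg"
    then have "s (t x) = neg (t x)" for x by simp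
    then show False using nc by (auto simp: s_def tm fun_eq_iff)
  qed
  then have "u \<noteq> id" by (metis comp_apply id_apply neg_neg(1) u_def ext)
  have ue: "u ^^ (2 ^ (2 + Suc k)) = id" by (rule deck_order[OF uD])
  define j where "j = (LEAST e. u ^^ (2 ^ e) = id)"
  have j: "u ^^ (2 ^ j) = id" unfolding j_def by (rule LeastI) (rule ue)
  have min: "u ^^ (2 ^ i) \<noteq> id" if "i < j" for i using that not_less_Least unfolding j_def by blast
  have "j \<noteq> 0" using j \<open>u \<noteq> id\<close> by (metis comp_id funpow.simps(1) funpow.simps(2) One_nat_def power_0)
  then obtain i where i: "j = Suc i" using not0_implies_Suc by blast
  \<comment> \<open>The order of u is 2^j with j > 0, so its power with exponent 2^(j - 1) is the
    involution z.\<close>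
  define n :: nat where "n = 2 ^ i"
  define z where "z = u ^^ n"
  have zid: "z \<noteq> id" using min[of i] i by (simp add: z_def n_def)
  have zz: "z (z x) = x" for x
    using j by (simp add: i z_def n_def mult_2 funpow_add fun_eq_iff)
  have zD: "z \<in> Deck (g ^^ Suc k)" unfolding z_def by (intro Deck_funpow uD)
  note zm = mobius_inv_simps[OF DeckD(1)[OF zD]]
  have unu: "u (neg (u x)) = neg x" for x by (simp add: u_def ss)
  \<comment> \<open>As a product of two involutions, u is inverted by conjugation with
    \<open>neg\<close>, and so are its powers. The involution z is its own inverse and hence
    commutes with \<open>neg\<close>.\<close>
  have "(u ^^ m) (neg ((u ^^ m) x)) = neg x" for m x
  proof (induction m arbitrary: x)
    case (Suc m)
    have "(u ^^ Suc m) (neg ((u ^^ Suc m) x)) = (u ^^ m) (u (neg (u ((u ^^ m) x))))"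
      by (simp add: funpow_swap1)
    then show ?case using Suc unu by simp
  qed simp
  then have "z (neg x) = neg (z x)" for x unfolding z_def by (metis zz z_def)
  then have zc: "z ` crit \<subseteq> crit" by (rule crit_if_commute)
  show ?thesis
  proof (cases "z (Some 0) = None")
    case True then show ?thesis using that zD by blast
  next
    \<comment> \<open>If z fixes 0, it is a nontrivial rotation of order 2, that is,
      \<open>neg\<close>. Then \<open>neg\<close> is a power of u and commutes with u, so u is an
      involution and equals z. This makes s, and with it its conjugate \<open>neg\<close>, the
      identity.\<close>
    case False
    then have "z (Some 0) = Some 0" using zc by auto
    then obtain c where c: "c \<noteq> 0" "z = rot c"
      using mobius_crit[OF DeckD(1)[OF zD] zc] rot_simps(4) by auto
    have "c * c = 1" using zz[of "Some 1"] c by simp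
    moreover have "c \<noteq> 1" using zid c rot_1 by auto
    ultimately have "c = -1" by (simp add: square_eq_1_iff)
    then have zn: "z = neg" using c neg_eq_rot by simp
    have "neg (u x) = u (neg x)" for x
      unfolding zn[symmetric] z_def by (simp add: funpow_swap1)
    then have uu: "u (u x) = x" for x using unu[of "neg x"] by simp
    have "u ^^ (2 ^ 1) = id" using uu by (auto simp: numeral_2_eq_2 fun_eq_iff)
    then have "j \<le> 1" unfolding j_def by (rule Least_le)
    then have "i = 0" using i by simp
    then have "z = u" by (simp add: z_def n_def)
    then have "neg (s x) = neg x" for x using zn by (metis comp_apply u_def)
    then have sx: "s x = x" for x by (metis neg_neg(1))
    have "neg y = y" for y using sx[of "t y"] by (simp add: s_def tm)
    then have "neg (Some 1) = Some 1" by blast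
    then show ?thesis using neg_eq_self_iff[of "Some 1"] by simp
  qed
qed

lemma deck_preserves_crit:
  assumes "t \<in> Deck (g ^^ k)"
  shows "t ` crit \<subseteq> crit"
proof (cases "t \<circ> neg = neg \<circ> t")
  case True
  then show ?thesis by (intro crit_if_commute) (metis comp_apply)
next
  case nc: False
  \<comment> \<open>One more iteration puts \<open>neg\<close> among the deck transformations even
    for k = 0.\<close>
  let ?K = "Suc k"
  have t: "t \<in> Deck (g ^^ ?K)" using assms Deck_funpow_mono[of k g 1] by auto
  obtain r where r: "r \<in> Deck (g ^^ ?K)" "r (Some 0) = None" using deck_swap[OF t nc] by blast
  \<comment> \<open>If t and \<open>neg \<circ> t\<close> were both involutions, t would commute
    with \<open>neg\<close>.\<close>
  obtain t1 where t1: "t1 \<in> Deck (g ^^ ?K)" "t1 \<circ> t1 \<noteq> id"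
  proof (cases "t \<circ> t = id")
    case True
    have "(neg \<circ> t) \<circ> (neg \<circ> t) \<noteq> id"
    proof
      assume a: "(neg \<circ> t) \<circ> (neg \<circ> t) = id"
      have "t (neg x) = neg (t x)" for x
      proof -
        have "neg (t (neg (t (t x)))) = t x" using a by (metis comp_apply id_apply)
        moreover have "t (t x) = x" using True by (metis comp_apply id_apply)
        ultimately show ?thesis by (metis neg_neg(1))
      qed
      then show False using nc by (auto simp: fun_eq_iff)
    qed
    then show ?thesis using that[of "neg \<circ> t"] Deck_comp[OF neg_in_Deck t] by blast
  next
    case False then show ?thesis using that t by blast
  qed
  have "t1 \<noteq> id" using t1(2) by auto
  obtain y where y: "t1 y = y" using mobius_fixed_point[OF DeckD(1)[OF t1(1)]] by blast
  have Vy: "V ?K y \<ge> 2" by (rule deck_fixed_visits[OF t1(1) y \<open>t1 \<noteq> id\<close> t1(2)])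
  have V: "V ?K None = V ?K (Some 0)" using deck_visits[OF r(1), of "Some 0"] r(2) by simp
  have G: "(g ^^ ?K) None = (g ^^ ?K) (Some 0)" using DeckD(3)[OF r(1), of "Some 0"] r(2) by simp
  \<comment> \<open>From its first visit on, the orbit of the fixed point y is that of a critical
    point, which therefore makes at least as many visits as y; r equates the counts of the two
    critical points.\<close>
  have "V ?K y > 0" using Vy by linarith
  then obtain s where s: "s < ?K" "(g ^^ s) y \<in> crit" "V ?K y = V (?K - s) ((g ^^ s) y)"
    by (rule first_visit)
  have "V (?K - s) ((g ^^ s) y) \<le> V ?K ((g ^^ s) y)"
    using visits_add[of g crit "?K - s" s "(g ^^ s) y"] s(1) by simp
  moreover have "V ?K ((g ^^ s) y) = V ?K (Some 0)" using s(2) V by auto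
  ultimately have V2: "V ?K (Some 0) \<ge> 2" using Vy s(3) by linarith
  show ?thesis
  proof
    fix x assume "x \<in> t ` crit"
    then obtain c where c: "c \<in> crit" "x = t c" by blast
    have "(g ^^ ?K) x = (g ^^ ?K) (Some 0)" using c G DeckD(3)[OF t, of c] by auto
    moreover have "V ?K x = V ?K (Some 0)" using c V deck_visits[OF t, of c] by auto
    ultimately show "x \<in> crit"
      using no_synchronous_point[where g = g and k = ?K and a = "Some 0" and b = None, OF refl G] V V2 by blast
  qed
qed

end

section \<open>Cyclic and dihedral 2-groups\<close>

lemma two_power_times_odd: "n > 0 \<Longrightarrow> \<exists>l q. n = 2 ^ l * q \<and> odd (q :: nat)"
proof (induction n rule: less_induct)
  case (less n)
  show ?case
  proof (cases "odd n")
    case True then show ?thesis by (metis mult_1 power_0)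
  next
    case False
    then obtain m where m: "n = 2 * m" by (auto elim: evenE)
    then obtain l q where "m = 2 ^ l * q" "odd q" using less.IH[of m] less.prems by auto
    then have "n = 2 ^ Suc l * q \<and> odd q" using m by simp
    then show ?thesis by blast
  qed
qed

lemma power_mod_period:
  fixes c :: complex
  assumes "c ^ N = 1" shows "c ^ (n mod N) = c ^ n"
proof -
  have "c ^ n = c ^ (N * (n div N) + n mod N)" by simp
  also have "\<dots> = (c ^ N) ^ (n div N) * c ^ (n mod N)" by (simp only: power_add power_mult)
  also have "\<dots> = c ^ (n mod N)" using assms by simp
  finally show ?thesis by simp
qed

text \<open>With m the least exponent such that 2^m kills R, some c in R has exact order 2^m. Its
  powers are already as many as the 2^m-th roots of unity, so they exhaust R.\<close>

lemma two_group_of_roots_of_unity: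
  fixes R :: "complex set"
  assumes mult: "\<And>a b. a \<in> R \<Longrightarrow> b \<in> R \<Longrightarrow> a * b \<in> R" and m1: "-1 \<in> R"
    and tor: "\<And>c. c \<in> R \<Longrightarrow> c ^ (2 ^ n) = 1"
  obtains m c where "m \<ge> 1" "bij_betw (\<lambda>i. c ^ i) {0..<2 ^ m} R" "c ^ (2 ^ (m - 1)) = -1"
    "c ^ (2 ^ m) = 1"
proof -
  define m where "m = (LEAST m. \<forall>c\<in>R. c ^ (2 ^ m) = 1)"
  have m: "\<forall>c\<in>R. c ^ (2 ^ m) = 1"
    unfolding m_def by (rule LeastI[of _ n]) (use tor in blast)
  have "m \<noteq> 0"
  proof
    assume "m = 0"
    then show False using bspec[OF m m1] by simp
  qed
  then have "m \<ge> 1" by simp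
  then obtain c where c: "c \<in> R" "c ^ (2 ^ (m - 1)) \<noteq> 1"
    using not_less_Least[of "m - 1" "\<lambda>m. \<forall>c\<in>R. c ^ (2 ^ m) = 1"] unfolding m_def[symmetric] by auto
  have c1: "c ^ (2 ^ m) = 1" using m c by blast
  have "(c ^ (2 ^ (m - 1)))^2 = c ^ (2 ^ m)"
    using \<open>m \<ge> 1\<close> by (simp add: power_mult[symmetric] power_Suc2[symmetric] del: power_Suc)
  then have cm: "c ^ (2 ^ (m - 1)) = -1" using c c1 by (simp add: power2_eq_1_iff)
  have c0: "c \<noteq> 0" using c1 by (auto simp: power_0_left)
  have free: "c ^ d \<noteq> 1" if d: "0 < d" "d < 2 ^ m" for d
  proof
    assume a: "c ^ d = 1"
    \<comment> \<open>Raising c^d = 1 to the power 2^(m-1-l) gives (-1)^q = 1, impossible for odd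
      q.\<close>
    obtain l q where lq: "d = 2 ^ l * q" "odd q" using two_power_times_odd[OF d(1)] by blast
    have "(2::nat) ^ l \<le> d" using lq d by (cases q) auto
    then have "(2::nat) ^ l < 2 ^ m" using d by linarith
    then have "l < m" by simp
    then have "(2::nat) ^ (m - 1) = 2 ^ l * 2 ^ (m - 1 - l)" by (simp add: power_add[symmetric])
    then have "(c ^ d) ^ (2 ^ (m - 1 - l)) = (c ^ (2 ^ (m - 1))) ^ q"
      unfolding lq(1) power_mult[symmetric] by (simp add: ac_simps)
    then show False using a cm lq(2) by (simp add: one_neq_neg_one)
  qed
  have inj: "inj_on (\<lambda>i. c ^ i) {0..<2 ^ m}"
  proof (rule linorder_inj_onI')
    fix i j :: nat assume ij: "i \<in> {0..<2 ^ m}" "j \<in> {0..<2 ^ m}" "i < j"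
    show "c ^ i \<noteq> c ^ j"
    proof
      assume "c ^ i = c ^ j"
      also have "c ^ j = c ^ i * c ^ (j - i)" using ij by (simp add: power_add[symmetric])
      finally have "c ^ (j - i) = 1" using c0 by simp
      then show False using free[of "j - i"] ij less_imp_diff_less[of j "2 ^ m" i] by auto
    qed
  qed
  have one: "1 \<in> R" using mult[OF m1 m1] by simp
  have sub1: "(\<lambda>i. c ^ i) ` {0..<2 ^ m} \<subseteq> R"
  proof -
    have "c ^ i \<in> R" for i by (induction i) (auto simp: one mult c(1))
    then show ?thesis by blast
  qed
  have sub2: "R \<subseteq> {z. z ^ (2 ^ m) = 1}" using m by blast
  have fin: "finite {z :: complex. z ^ (2 ^ m) = 1}" and "card {z :: complex. z ^ (2 ^ m) = 1} \<le> 2 ^ m"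
    by (rule finite_roots_unity card_roots_unity; simp)+
  then have "card R \<le> card ((\<lambda>i. c ^ i) ` {0..<2 ^ m})"
    using card_mono[OF fin sub2] by (simp add: card_image[OF inj])
  then have "(\<lambda>i. c ^ i) ` {0..<2 ^ m} = R"
    using card_seteq[OF finite_subset[OF sub2 fin] sub1] by blast
  then show ?thesis using that[OF \<open>m \<ge> 1\<close> _ cm c1] inj by (simp add: bij_betw_def)
qed

text \<open>An explicit parametrisation of the deck group by the model group is inverted to obtain
  the isomorphism in the required direction.\<close>

lemma is_iso_deckI:
  assumes "bij_betw h (carrier Z) (Deck F)"
    and "\<And>x y. x \<in> carrier Z \<Longrightarrow> y \<in> carrier Z \<Longrightarrow> mult Z x y \<in> carrier Z \<and> h (mult Z x y) = h x \<circ> h y"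
  shows "deck_group F \<cong> Z"
proof -
  let ?k = "inv_into (carrier Z) h"
  have k: "?k x \<in> carrier Z" "h (?k x) = x" if "x \<in> Deck F" for x
    using that assms(1) by (auto simp: bij_betw_def inv_into_into f_inv_into_f)
  have "?k (x \<circ> y) = mult Z (?k x) (?k y)" if "x \<in> Deck F" "y \<in> Deck F" for x y
  proof -
    have "x \<circ> y = h (mult Z (?k x) (?k y))" using assms(2)[OF k(1)[OF that(1)] k(1)[OF that(2)]] k(2) that by simp
    then show ?thesis using assms(2)[OF k(1)[OF that(1)] k(1)[OF that(2)]] assms(1)
      by (metis bij_betw_def inv_into_f_f)
  qed
  then have "?k \<in> iso (deck_group F) Z"
    unfolding iso_def hom_def using bij_betw_inv_into[OF assms(1)] k(1)
    by (simp add: deck_group_def)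
  then show ?thesis by (rule is_isoI)
qed

section \<open>The deck groups of the normal form\<close>

context mobius_square
begin

definition R :: "nat \<Rightarrow> complex set" where "R k = {c. c \<noteq> 0 \<and> rot c \<in> Deck (g ^^ k)}"

lemma RD: "c \<in> R k \<Longrightarrow> c \<noteq> 0" "c \<in> R k \<Longrightarrow> rot c \<in> Deck (g ^^ k)"
  by (auto simp: R_def)

lemma R_mult: "a \<in> R k \<Longrightarrow> b \<in> R k \<Longrightarrow> a * b \<in> R k"
  using Deck_comp[of "rot a" _ "rot b"] by (auto simp: R_def rot_comp)

lemma R_torsion: "c \<in> R k \<Longrightarrow> c ^ (2 ^ (2 + k)) = 1"
proof -
  assume "c \<in> R k"
  then have "(rot c ^^ (2 ^ (2 + k))) (Some 1) = Some 1" using deck_order[of "rot c" k] by (simp add: R_def)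
  moreover have "(rot c ^^ n) (Some 1) = Some (c ^ n)" for n by (induction n) auto
  ultimately show ?thesis by simp
qed

lemma neg1_in_R: "-1 \<in> R (Suc k)"
  using neg_in_Deck[of k] neg_eq_rot by (simp add: R_def)

lemma deck_cases:
  assumes "t \<in> Deck (g ^^ k)"
  obtains c where "c \<in> R k" "t = rot c" | c where "c \<noteq> 0" "t = flip c"
  using mobius_crit[OF DeckD(1)[OF assms] deck_preserves_crit[OF assms]] assms that by (auto simp: R_def)

text \<open>Multiplication by q descends to \<open>q\<^sup>2\<close>, and \<open>M \<circ> rot (q\<^sup>2) \<circ> M\<inverse>\<close> is a deck transformation of the
  previous iterate. It preserves the critical set and has order 4, so it fixes just the two
  critical points; but it also fixes their images under M.\<close>

lemma primitive_8th_root_in_R: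
  assumes q: "q \<in> R k" "q ^ 4 = -1"
  shows "M ` crit \<subseteq> crit"
proof (cases k)
  case 0
  then have "rot q = id" using RD(2)[OF q(1)] by (auto simp: Deck_def)
  then have "q = 1" using rot_simps(2)[of q] by simp
  then show ?thesis using q(2) by (simp add: one_neq_neg_one)
next
  case (Suc j)
  note Mm = mobius_inv_simps[OF M]
  define h where "h = M \<circ> rot (q^2) \<circ> sinv M"
  have q0: "q \<noteq> 0" using RD(1)[OF q(1)] .
  have hD: "h \<in> Deck (g ^^ j)"
  proof (rule DeckI)
    show "is_mobius h" unfolding h_def
      using q0 by (intro is_mobius_comp M is_mobius_rot is_mobius_inverse) auto
    fix x
    \<comment> \<open>The point u is a preimage of x under g, and g carries its rotation by q to
      \<open>h x\<close>.\<close>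
    obtain u where u: "sq u = sinv M x" using surj_sq by blast
    have "h x = g (rot q u)" by (simp add: h_def g_def sq_rot[OF q0] u)
    moreover have "x = g u" by (simp add: g_def u Mm)
    moreover have "(g ^^ Suc j) (rot q u) = (g ^^ Suc j) u"
      using DeckD(3)[OF RD(2)[OF q(1)]] Suc by blast
    ultimately show "(g ^^ j) (h x) = (g ^^ j) x" by (simp add: funpow_swap1)
  qed
  have hh: "h \<circ> h \<noteq> id"
  proof
    assume "h \<circ> h = id"
    then have "h (h (M (Some 1))) = M (Some 1)" by (metis comp_apply id_apply)
    then have "M (rot (q^2) (rot (q^2) (Some 1))) = M (Some 1)" by (simp add: h_def Mm)
    then have "q^2 * q^2 = 1" by (simp add: Mm)
    then show False using q(2) by (simp add: power_add[symmetric] one_neq_neg_one)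
  qed
  from hD obtain e where e: "e \<noteq> 0" "h = rot e"
  proof (cases rule: deck_cases)
    case (1 c) then show ?thesis using that RD(1) by blast
  next
    case (2 c)
    then have "h \<circ> h = id" using rot_comp(4)[of c c] rot_1 by simp
    then show ?thesis using hh by simp
  qed
  have "e \<noteq> 1" using e(2) hh rot_1 by auto
  show ?thesis
  proof
    fix y assume "y \<in> M ` crit"
    then obtain x where x: "x \<in> crit" "y = M x" by blast
    have "h y = y" using x q0 by (auto simp: h_def Mm)
    then show "y \<in> crit" using e \<open>e \<noteq> 1\<close> by (cases y) auto
  qed
qed

text \<open>Squaring fixes 0 and infinity and M permutes them, so their images under every iterate
  stay distinct. A flip would force equal images.\<close>

lemma M_crit_no_flip:
  assumes "M ` crit \<subseteq> crit"
  shows "flip d \<notin> Deck (g ^^ k)"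
proof
  assume "flip d \<in> Deck (g ^^ k)"
  then have eq: "(g ^^ k) (Some 0) = (g ^^ k) None" using DeckD(3)[of "flip d" "g ^^ k" "Some 0"] by simp
  have M0: "M (Some 0) \<noteq> M None" using mobius_inv_simps(5)[OF M] by simp
  have g: "g (Some 0) = M (Some 0)" "g None = M None" by (simp_all add: g_def sq_def)
  have "(g ^^ n) (Some 0) \<in> crit \<and> (g ^^ n) None \<in> crit \<and> (g ^^ n) (Some 0) \<noteq> (g ^^ n) None" for n
    by (induction n) (use assms M0 g in auto)
  then show False using eq by blast
qed

text \<open>The rotations form a cyclic group of order 2^m. Without flips this is the whole group.
  With flips, m is at most 2, and one flip extends the rotations to V4 for m = 1 and to D8 for m =
  2.\<close>

lemma deck_group_cases:
  "(\<exists>n\<ge>1. deck_group (g ^^ Suc k) \<cong> integer_mod_group (2 ^ n) \<and> (n \<le> 2 \<or> M ` crit \<subseteq> crit))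
    \<or> deck_group (g ^^ Suc k) \<cong> V4 \<or> deck_group (g ^^ Suc k) \<cong> D8"
proof -
  let ?K = "Suc k" and ?D = "Deck (g ^^ Suc k)"
  obtain m c where mc: "m \<ge> 1" "bij_betw (\<lambda>i. c ^ i) {0..<2 ^ m} (R ?K)" "c ^ (2 ^ (m - 1)) = -1"
    "c ^ (2 ^ m) = 1"
    by (rule two_group_of_roots_of_unity[OF R_mult neg1_in_R R_torsion])
  have c0: "c \<noteq> 0" using mc(4) by (auto simp: power_0_left)
  have cR: "c ^ i \<in> R ?K" for i
    using bij_betwE[OF mc(2)] power_mod_period[OF mc(4), of i] by (metis atLeastLessThan_iff mod_less_divisor zero_le zero_less_numeral zero_less_power)
  have Rc: "\<exists>i<2 ^ m. a = c ^ i" if "a \<in> R ?K" for a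
  proof -
    have "a \<in> (\<lambda>i. c ^ i) ` {0..<2 ^ m}" using that mc(2) by (simp only: bij_betw_def)
    then show ?thesis by auto
  qed
  have cinj: "i = j" if "c ^ i = c ^ j" "i < 2 ^ m" "j < 2 ^ m" for i j
    using that mc(2) by (auto simp: bij_betw_def inj_on_def)
  have small: "m \<le> 2 \<or> M ` crit \<subseteq> crit"
  proof (rule disjCI)
    assume n: "\<not> M ` crit \<subseteq> crit"
    show "m \<le> 2"
    proof (rule ccontr)
      assume "\<not> m \<le> 2"
      \<comment> \<open>For m at least 3 the power of c with exponent 2^(m-3) is a primitive 8th
        root of unity.\<close>
      then have "m - 1 = (m - 3) + 2" by simp
      then have "(2::nat) ^ (m - 1) = 2 ^ (m - 3) * 4" by (simp only: power_add) simp
      then have "(c ^ (2 ^ (m - 3))) ^ 4 = -1" using mc(3) by (simp only: power_mult)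
      from primitive_8th_root_in_R[OF cR this] show False using n by simp
    qed
  qed
  show ?thesis
  proof (cases "\<exists>d. d \<noteq> 0 \<and> flip d \<in> ?D")
    case False
    have D: "t \<in> ?D \<Longrightarrow> \<exists>a\<in>R ?K. t = rot a" for t using False by (metis deck_cases)
    have "deck_group (g ^^ ?K) \<cong> integer_mod_group (2 ^ m)"
    proof (rule is_iso_deckI[of "\<lambda>i. rot (c ^ nat i)"])
      show "bij_betw (\<lambda>i. rot (c ^ nat i)) (carrier (integer_mod_group (2 ^ m))) ?D"
        unfolding bij_betw_def carrier_integer_mod_group
      proof (intro conjI)
        show "inj_on (\<lambda>i. rot (c ^ nat i)) (if (2::nat) ^ m = 0 then UNIV else {0..<int (2 ^ m)})"
          by (auto simp: inj_on_def rot_inj nat_less_iff dest!: cinj)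
        show "(\<lambda>i. rot (c ^ nat i)) ` (if (2::nat) ^ m = 0 then UNIV else {0..<int (2 ^ m)}) = ?D"
        proof (intro equalityI subsetI)
          fix t assume "t \<in> ?D"
          then obtain i where i: "i < 2 ^ m" "t = rot (c ^ i)" using D Rc by blast
          then show "t \<in> (\<lambda>i. rot (c ^ nat i)) ` (if (2::nat) ^ m = 0 then UNIV else {0..<int (2 ^ m)})"
            by (intro image_eqI[of _ _ "int i"]) auto
        qed (use RD(2)[OF cR] in auto)
      qed
      fix x y assume "x \<in> carrier (integer_mod_group (2 ^ m))" "y \<in> carrier (integer_mod_group (2 ^ m))"
      then have xy: "0 \<le> x" "0 \<le> y" by (auto simp: carrier_integer_mod_group)
      have "nat ((x + y) mod int (2 ^ m)) = (nat x + nat y) mod 2 ^ m"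
        using xy by (simp add: nat_mod_distrib nat_add_distrib nat_power_eq)
      then have "c ^ nat ((x + y) mod int (2 ^ m)) = c ^ nat x * c ^ nat y"
        by (simp only: power_mod_period[OF mc(4)] power_add)
      then show "mult (integer_mod_group (2 ^ m)) x y \<in> carrier (integer_mod_group (2 ^ m)) \<and>
          rot (c ^ nat (mult (integer_mod_group (2 ^ m)) x y)) = rot (c ^ nat x) \<circ> rot (c ^ nat y)"
        using c0 by (simp add: carrier_integer_mod_group rot_comp)
    qed
    then show ?thesis using mc(1) small by blast
  next
    case True
    then obtain d where d: "d \<noteq> 0" "flip d \<in> ?D" by blast
    then have "m \<le> 2" using M_crit_no_flip small by blast
    \<comment> \<open>The coordinates of \<open>D8\<close>: an exponent of the rotation c and a bit
      telling whether the fixed flip is applied first.\<close>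
    define h where "h = (\<lambda>(a, e :: nat). rot (c ^ a) \<circ> (if e = 0 then id else flip d))"
    have h0: "h (a, 0) = rot (c ^ a)" and h1: "h (a, Suc 0) = flip (c ^ a * d)" for a
      using c0 d(1) by (simp_all add: h_def rot_comp)
    have inD: "h p \<in> ?D" for p
      unfolding h_def using RD(2)[OF cR] d(2) Deck_id by (auto split: prod.split intro!: Deck_comp)
    have onto: "\<exists>a e. a < 2 ^ m \<and> e < 2 \<and> t = h (a, e)" if t: "t \<in> ?D" for t
      using t
    proof (cases rule: deck_cases)
      case (1 a)
      then obtain i where "i < 2 ^ m" "a = c ^ i" using Rc by blast
      then have "i < 2 ^ m \<and> (0::nat) < 2 \<and> t = h (i, 0)" using 1 h0 by simp
      then show ?thesis by blast
    next
      case (2 a)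
      \<comment> \<open>Two flips differ by a rotation, so one flip together with R yields them
        all.\<close>
      have "rot (a / d) \<in> ?D" using Deck_comp[OF t d(2)] rot_comp(4)[of a d] 2 d by simp
      then have "a / d \<in> R ?K" using 2 d by (simp add: R_def)
      then obtain i where i: "i < 2 ^ m" "a / d = c ^ i" using Rc by blast
      then have "a = c ^ i * d" using d by (simp add: field_simps)
      then have "i < 2 ^ m \<and> Suc 0 < 2 \<and> t = h (i, Suc 0)" using 2 i h1 by simp
      then show ?thesis by blast
    qed
    have hinj: "a = b \<and> e = f" if "h (a, e) = h (b, f)" "a < 2 ^ m" "b < 2 ^ m" "e < 2" "f < 2" for a b e f
    proof -
      have ef: "e = 0 \<or> e = Suc 0" "f = 0 \<or> f = Suc 0" using that by auto
      show ?thesis using ef that(1-3) c0 d(1) rot_neq_flip rot_neq_flip[symmetric]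
        by (auto simp: h0 h1 rot_inj flip_inj dest: cinj)
    qed
    have bij: "bij_betw h ({0..<2 ^ m} \<times> {0..<2}) ?D"
      unfolding bij_betw_def
    proof (intro conjI equalityI subsetI)
      show "inj_on h ({0..<2 ^ m} \<times> {0..<2})" unfolding inj_on_def using hinj by auto
      show "t \<in> ?D" if "t \<in> h ` ({0..<2 ^ m} \<times> {0..<2})" for t using that inD by auto
      show "t \<in> h ` ({0..<2 ^ m} \<times> {0..<2})" if "t \<in> ?D" for t using onto[OF that] by force
    qed
    \<comment> \<open>A flip inverts rotations, hence the exponent 2^m - b. For m = 2 this is the
      law of \<open>D8\<close>; for m = 1 inversion is trivial and the law is that of
      \<open>V4\<close>.\<close>
    have hom: "h (a, e) \<circ> h (b, f) = h ((a + (if e = 0 then b else 2 ^ m - b)) mod 2 ^ m, (e + f) mod 2)"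
      if "b < 2 ^ m" "e < 2" "f < 2" for a b e f
    proof -
      have inv: "c ^ (2 ^ m - b) = 1 / c ^ b"
        using that(1) mc(4) c0 by (simp add: power_diff)
      have ef: "e = 0 \<or> e = Suc 0" "f = 0 \<or> f = Suc 0" using that by auto
      then show ?thesis
        using c0 d(1) by (auto simp: h0 h1 rot_comp power_mod_period[OF mc(4)] power_add inv field_simps)
    qed
    show ?thesis
    proof (cases "m = 1")
      case True
      have carr: "carrier V4 = {0..<2} \<times> {0..<2}"
        by (simp add: V4_def DirProd_def carrier_integer_mod_group)
      have "deck_group (g ^^ ?K) \<cong> V4"
      proof (rule is_iso_deckI[of "\<lambda>(a, e). h (nat a, nat e)"])
        have "bij_betw (map_prod nat nat) (carrier V4) ({0..<2 ^ m} \<times> {0..<2})"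
          unfolding carr True by (rule bij_betw_byWitness[of _ "map_prod int int"]) auto
        from bij_betw_trans[OF this bij]
        show "bij_betw (\<lambda>(a, e). h (nat a, nat e)) (carrier V4) ?D"
          by (rule bij_betw_cong[THEN iffD1, rotated]) auto
        fix x y assume "x \<in> carrier V4" "y \<in> carrier V4"
        moreover obtain a e b f where "x = (a, e)" "y = (b, f)" by (cases x, cases y)
        ultimately have xy: "x = (a, e)" "y = (b, f)" "a = 0 \<or> a = 1" "e = 0 \<or> e = 1" "b = 0 \<or> b = 1" "f = 0 \<or> f = 1"
          unfolding carr by auto
        have m: "mult V4 x y = ((a + b) mod 2, (e + f) mod 2)"
          by (simp add: V4_def DirProd_def xy)
        have "h (nat a, nat e) \<circ> h (nat b, nat f) = h (nat ((a + b) mod 2), nat ((e + f) mod 2))"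
          using hom[of "nat b" "nat e" "nat f" "nat a"] xy(3-6) True by auto
        then show "mult V4 x y \<in> carrier V4 \<and>
          (case mult V4 x y of (a, e) \<Rightarrow> h (nat a, nat e)) =
          (case x of (a, e) \<Rightarrow> h (nat a, nat e)) \<circ> (case y of (a, e) \<Rightarrow> h (nat a, nat e))"
          unfolding m unfolding xy carr by simp
      qed
      then show ?thesis by blast
    next
      case False
      then have m2: "m = 2" using \<open>m \<le> 2\<close> mc(1) by linarith
      have "deck_group (g ^^ ?K) \<cong> D8"
      proof (rule is_iso_deckI[of h])
        show "bij_betw h (carrier D8) ?D" using bij by (simp add: D8_def m2)
        fix x y assume "x \<in> carrier D8" "y \<in> carrier D8"
        moreover obtain a e b f where "x = (a, e)" "y = (b, f)" by (cases x, cases y)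
        ultimately have xy: "x = (a, e)" "y = (b, f)" "b < 4" "e < 2" "f < 2" by (auto simp: D8_def)
        then show "mult D8 x y \<in> carrier D8 \<and> h (mult D8 x y) = h x \<circ> h y"
          using hom[of b e f a] by (simp add: D8_def m2)
      qed
      then show ?thesis by blast
    qed
  qed
qed

end

section \<open>Transfer to quadratic rational maps\<close>

lemma funpow_conj:
  assumes "is_mobius B"
  shows "(sinv B \<circ> g \<circ> B) ^^ n = sinv B \<circ> g ^^ n \<circ> B"
  by (induction n) (auto simp: fun_eq_iff mobius_inv_simps[OF assms])

lemma deck_group_conj:
  assumes B: "is_mobius B"
  shows "deck_group (sinv B \<circ> F \<circ> B) \<cong> deck_group F"
proof (rule is_iso_deckI[of "\<lambda>t. sinv B \<circ> t \<circ> B"])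
  note b = mobius_inv_simps[OF B]
  have iB: "sinv B x = sinv B y \<longleftrightarrow> x = y" for x y by (metis b(1))
  show "bij_betw (\<lambda>t. sinv B \<circ> t \<circ> B) (carrier (deck_group F)) (Deck (sinv B \<circ> F \<circ> B))"
    unfolding deck_group_def partial_object.simps
  proof (rule bij_betw_byWitness[of _ "\<lambda>t. B \<circ> t \<circ> sinv B"])
    show "(\<lambda>t. sinv B \<circ> t \<circ> B) ` Deck F \<subseteq> Deck (sinv B \<circ> F \<circ> B)"
      by (auto intro!: DeckI is_mobius_comp is_mobius_inverse B simp: b DeckD)
    show "(\<lambda>t. B \<circ> t \<circ> sinv B) ` Deck (sinv B \<circ> F \<circ> B) \<subseteq> Deck F"
    proof
      fix s assume "s \<in> (\<lambda>t. B \<circ> t \<circ> sinv B) ` Deck (sinv B \<circ> F \<circ> B)"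
      then obtain t where t: "t \<in> Deck (sinv B \<circ> F \<circ> B)" "s = B \<circ> t \<circ> sinv B" by blast
      show "s \<in> Deck F"
      proof (rule DeckI)
        show "is_mobius s" unfolding t(2)
          by (intro is_mobius_comp is_mobius_inverse(2) B DeckD(1)[OF t(1)])
        show "F (s x) = F x" for x using DeckD(3)[OF t(1), of "sinv B x"] by (simp add: t(2) b iB)
      qed
    qed
  qed (auto simp: fun_eq_iff b)
  fix x y assume "x \<in> carrier (deck_group F)" "y \<in> carrier (deck_group F)"
  then show "mult (deck_group F) x y \<in> carrier (deck_group F) \<and>
      sinv B \<circ> mult (deck_group F) x y \<circ> B = sinv B \<circ> x \<circ> B \<circ> (sinv B \<circ> y \<circ> B)"
    by (auto simp: deck_group_def Deck_comp fun_eq_iff b)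
qed

lemma complex_cube_root: obtains l :: complex where "l ^ 3 = a"
proof
  have "(root 3 (cmod a)) ^ 3 = cmod a" by (simp add: odd_real_root_pow)
  then show "rcis (root 3 (cmod a)) (Arg a / 3) ^ 3 = a" by (simp add: DeMoivre2 rcis_cmod_Arg)
qed

lemma pow_map_2: "pow_map 2 = sq"
  by (auto simp: fun_eq_iff pow_map_def rat_map_of_def sq_def poly_monom degree_monom_eq split: option.splits)

lemma inv_pow_map_2: "inv_pow_map 2 = flip 1 \<circ> sq"
proof
  fix s show "inv_pow_map 2 s = (flip 1 \<circ> sq) s"
    by (cases s) (auto simp: inv_pow_map_def rat_map_of_def sq_def poly_monom degree_monom_eq flip_def mob_def pr_def)
qed

text \<open>Here the normal form is a z^2 or a / z^2, and a scaling of the coordinate removes the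
  coefficient.\<close>

lemma is_power_map_if_crit:
  assumes B: "is_mobius B" and M: "is_mobius M" "M ` crit \<subseteq> crit"
  shows "is_power_map (sinv B \<circ> (M \<circ> sq) \<circ> B)"
proof -
  note b = mobius_inv_simps[OF B]
  from mobius_crit[OF M] show ?thesis
  proof (elim disjE exE conjE)
    fix a assume a: "a \<noteq> 0" "M = rot a"
    let ?m = "sinv B \<circ> rot (1 / a)"
    have "(sinv B \<circ> (M \<circ> sq) \<circ> B) \<circ> ?m = ?m \<circ> pow_map 2"
    proof
      fix x
      have "rot a (rot ((1 / a)^2) y) = rot (1 / a) y" for y
        using rot_comp(1)[of a "(1 / a)^2"] a(1) by (auto simp: fun_eq_iff power2_eq_square)
      then show "((sinv B \<circ> (M \<circ> sq) \<circ> B) \<circ> ?m) x = (?m \<circ> pow_map 2) x"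
        using a(1) by (simp add: b a(2) sq_rot pow_map_2)
    qed
    moreover have "is_mobius ?m" by (intro is_mobius_comp is_mobius_inverse B is_mobius_rot) (use a in simp)
    ultimately show ?thesis unfolding is_power_map_def by (metis one_le_numeral)
  next
    fix a assume a: "a \<noteq> 0" "M = flip a"
    \<comment> \<open>A scaling by l conjugates a / z^2 to z^(-2) exactly when a / l^2 = l.\<close>
    obtain l where l: "l ^ 3 = a" by (rule complex_cube_root)
    then have l0: "l \<noteq> 0" using a by auto
    let ?m = "sinv B \<circ> rot l"
    have "(sinv B \<circ> (M \<circ> sq) \<circ> B) \<circ> ?m = ?m \<circ> inv_pow_map 2"
    proof
      fix x
      have "a / l^2 = l" using l l0 by (auto simp: power3_eq_cube power2_eq_square)
      then have "flip a (rot (l^2) y) = rot l (flip 1 y)" for y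
        using rot_comp(3)[of a "l^2"] rot_comp(2)[of l 1] a(1) l0 by (auto simp: fun_eq_iff)
      then show "((sinv B \<circ> (M \<circ> sq) \<circ> B) \<circ> ?m) x = (?m \<circ> inv_pow_map 2) x"
        using l0 by (simp add: b a(2) sq_rot inv_pow_map_2)
    qed
    moreover have "is_mobius ?m" by (intro is_mobius_comp is_mobius_inverse B is_mobius_rot l0)
    ultimately show ?thesis unfolding is_power_map_def by (metis one_le_numeral)
  qed
qed

lemma card_deck:
  assumes "deck_group F \<cong> Z" "finite (carrier Z)" "card (carrier Z) \<le> 8"
  shows "finite (Deck F) \<and> card (Deck F) \<le> 8"
proof -
  obtain h where "bij_betw h (Deck F) (carrier Z)"
    using assms(1) by (auto simp: is_iso_def iso_def deck_group_def)
  then show ?thesis using bij_betw_finite bij_betw_same_card assms by metis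
qed

theorem theorem4:
  fixes f :: "sphere \<Rightarrow> sphere" and k :: nat
  assumes "is_rat_map f 2" and "k \<ge> 1"
  shows "((\<exists>n\<ge>1. deck_group (f ^^ k) \<cong> integer_mod_group (2 ^ n))
          \<or> deck_group (f ^^ k) \<cong> V4
          \<or> deck_group (f ^^ k) \<cong> D8)
         \<and> (\<not> is_power_map f \<longrightarrow> finite (Deck (f ^^ k)) \<and> card (Deck (f ^^ k)) \<le> 8)"
proof -
  obtain A B where AB: "is_mobius A" "is_mobius B" "f = A \<circ> sq \<circ> B"
    using quadratic_map_normal_form[OF assms(1)] by blast
  define M where "M = B \<circ> A"
  have M: "is_mobius M" unfolding M_def by (intro is_mobius_comp AB)
  interpret mobius_square M by unfold_locales (rule M)
  have f: "f = sinv B \<circ> g \<circ> B"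
    unfolding g_def unfolding M_def by (auto simp: fun_eq_iff AB(3) mobius_inv_simps[OF AB(2)])
  obtain j where k: "k = Suc j" using assms(2) not0_implies_Suc by fastforce
  have iso: "deck_group (f ^^ k) \<cong> Z" if "deck_group (g ^^ Suc j) \<cong> Z" for Z :: "'z monoid"
    using iso_trans[OF deck_group_conj[OF AB(2)] that] unfolding f k funpow_conj[OF AB(2)] .
  have power: "is_power_map f" if "M ` crit \<subseteq> crit"
    using is_power_map_if_crit[OF AB(2) M that] unfolding f g_def .
  have cV: "carrier V4 = {0..<2} \<times> {0..<2}" by (simp add: V4_def DirProd_def carrier_integer_mod_group)
  consider n where "n \<ge> 1" "deck_group (g ^^ Suc j) \<cong> integer_mod_group (2 ^ n)" "n \<le> 2 \<or> M ` crit \<subseteq> crit"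
    | "deck_group (g ^^ Suc j) \<cong> V4" | "deck_group (g ^^ Suc j) \<cong> D8"
    using deck_group_cases[of j] by blast
  then show ?thesis
  proof cases
    case 1
    have "finite (Deck (f ^^ k)) \<and> card (Deck (f ^^ k)) \<le> 8" if "\<not> is_power_map f"
    proof (rule card_deck[OF iso[OF 1(2)]])
      \<comment> \<open>A cyclic group of order above 4 would force M to preserve the critical set
        and f to be a power map.\<close>
      have "n \<le> 2" using 1 that power by blast
      then have "(2::nat) ^ n \<le> 2 ^ 2" by (intro power_increasing) auto
      then show "card (carrier (integer_mod_group (2 ^ n))) \<le> 8"
        by (simp add: carrier_integer_mod_group nat_power_eq)
    qed (simp add: carrier_integer_mod_group)
    then show ?thesis using 1(1) iso[OF 1(2)] by blast
  next
    case 2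
    have "finite (Deck (f ^^ k)) \<and> card (Deck (f ^^ k)) \<le> 8"
      by (rule card_deck[OF iso[OF 2]]) (simp_all add: cV)
    then show ?thesis using iso[OF 2] by blast
  next
    case 3
    have "finite (Deck (f ^^ k)) \<and> card (Deck (f ^^ k)) \<le> 8"
      by (rule card_deck[OF iso[OF 3]]) (simp_all add: D8_def)
    then show ?thesis using iso[OF 3] by blast
  qed
qed

end
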